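(* Let $X$ be a compact geodesic space and let $\{X_i\}$ be a sequence of compact geodesic spaces such that for all $i$ there is a basepoint preserving $\sigma_i$-isometry $f_i:X_i\to X$, for some sequence of constants $\sigma_i\to0$. Let $\varepsilon>0$, suppose that $\phi_{\varepsilon\omega_0}:X_{\omega_0}\to X_\varepsilon$ is injective, and let $\frac\varepsilon2<\omega_0<\delta<\varepsilon$. Then for all large $i$ the following hold. 1. $(f_i)_\#:(X_i)_\delta\to X_\varepsilon$ is a $p(\sigma_i,\varepsilon)$-isometry, and in particular $(X_i)_\delta$ is Gromov-Hausdorff pointed convergent to $X_\varepsilon$. 2. The restriction of $(f_i)_\#$ to $\pi_\delta(X_i)$, denoted $(f_i)_\theta$, is an isomorphism onto $\pi_\varepsilon(X)$. 3. $(f_i)_\#$ is equivariant with respect to $(f_i)_\theta$, i.e. $(f_i)_\#(g\cdot x)=(f_i)_\theta(g)\cdot(f_i)_\#(x)$ for all $g\in\pi_\delta(X_i)$ and $x\in(X_i)_\delta$.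
   Context: A geodesic space is a metric space in which any two points are joined by a path whose length equals their distance. All spaces have base points $*$. For $\varepsilon>0$, an $\varepsilon$-chain in a metric space $X$ is a finite sequence $\{x_0,\dots,x_n\}$ with $d(x_i,x_{i+1})<\varepsilon$ for all $i$. An $\varepsilon$-homotopy is a finite sequence of $\varepsilon$-chains, each obtained from its predecessor by adding or removing a single point, endpoints always fixed; $[\alpha]_\varepsilon$ is the $\varepsilon$-homotopy class of $\alpha$. $X_\varepsilon$ is the set of all $[\alpha]_\varepsilon$ with $\alpha$ an $\varepsilon$-chain starting at $*$, with base point $[*]_\varepsilon$ and metric $d([\alpha]_\varepsilon,[\beta]_\varepsilon)=\inf\{L(\gamma):\gamma\in[\overline\alpha*\beta]_\varepsilon\}$, where $L(\{x_0,\dots,x_n\})=\sum_i d(x_{i-1},x_i)$, $\overline\alpha$ is the reversal and $*$ between chains is concatenation. $\pi_\varepsilon(X)\subset X_\varepsilon$ is the group of classes of $\varepsilon$-loops based at $*$ under concatenation, acting on $X_\varepsilon$ by isometries by preconcatenation. For $\delta\ge\varepsilon$, $\phi_{\delta\varepsilon}:X_\varepsilon\to X_\delta$ is $[\alpha]_\varepsilon\mapsto[\alpha]_\delta$. $\sigma$-isometry. Let $\sigma$ be a first degree polynomial with non-negative coefficients (constants allowed). A function $f:X\to Y$ between metric spaces is a $\sigma$-isometry if for all $x,y\in X$ and $z\in Y$: (1) $|d(x,y)-d(f(x),f(y))|\le\sigma(d(x,y))$ and (2) $d(z,f(w))\le\sigma(0)$ for some $w\in X$. Induced map. If $f:X\to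 Y$ is basepoint preserving and $d(x,y)<\delta$ implies $d(f(x),f(y))<\varepsilon$, then $f_\#:X_\delta\to Y_\varepsilon$ is the well-defined map $f_\#([\{x_0,\dots,x_n\}]_\delta)=[\{f(x_0),\dots,f(x_n)\}]_\varepsilon$. $p(\sigma,\varepsilon)$ is the first degree polynomial $$p(\sigma,\varepsilon)(t)=\sigma\left(\frac4\varepsilon+\frac{16\sigma}{\varepsilon^2}\right)t+\sigma\left(\frac{4\sigma}{\varepsilon}+1\right).$$ *)

theory Defs
  imports
    "HOL-Analysis.Analysis"
    "HOL-Algebra.Group"
    "HOL-Computational_Algebra.Polynomial"
begin

section \<open>Geodesic spaces\<close>

fun chain_length :: "'a metric \<Rightarrow> 'a list \<Rightarrow> real" where
  "chain_length X (x # y # xs) = mdist X x y + chain_length X (y # xs)"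
| "chain_length X _ = 0"

text \<open>The supremum is over all finite partitions of the unit interval; it may be infinite.\<close>

definition path_length :: "'a metric \<Rightarrow> (real \<Rightarrow> 'a) \<Rightarrow> ennreal" where
  "path_length X g =
     (SUP ts \<in> {ts. sorted ts \<and> set ts \<subseteq> {0..1}}. ennreal (chain_length X (map g ts)))"

definition geodesic_space :: "'a metric \<Rightarrow> bool" where
  "geodesic_space X \<longleftrightarrow>
     (\<forall>x \<in> mspace X. \<forall>y \<in> mspace X. \<exists>g. pathin (mtopology_of X) g \<and> g 0 = x \<and> g 1 = y \<and>
        path_length X g = ennreal (mdist X x y))"

definition compact_geodesic_space :: "'a metric \<Rightarrow> bool" where
  "compact_geodesic_space X \<longleftrightarrow> compact_space (mtopology_of X) \<and> geodesic_space X"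

section \<open>Discrete homotopy\<close>

definition eps_chain :: "'a metric \<Rightarrow> real \<Rightarrow> 'a list \<Rightarrow> bool" where
  "eps_chain X \<epsilon> \<alpha> \<longleftrightarrow>
     \<alpha> \<noteq> [] \<and> set \<alpha> \<subseteq> mspace X \<and> successively (\<lambda>x y. mdist X x y < \<epsilon>) \<alpha>"

definition adds_point :: "'a list \<Rightarrow> 'a list \<Rightarrow> bool" where
  "adds_point \<alpha> \<beta> \<longleftrightarrow>
     (\<exists>xs z ys. \<alpha> = xs @ ys \<and> \<beta> = xs @ z # ys) \<and> hd \<alpha> = hd \<beta> \<and> last \<alpha> = last \<beta>"

definition eps_step :: "'a metric \<Rightarrow> real \<Rightarrow> 'a list \<Rightarrow> 'a list \<Rightarrow> bool" where
  "eps_step X \<epsilon> \<alpha> \<beta> \<longleftrightarrow>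
     eps_chain X \<epsilon> \<alpha> \<and> eps_chain X \<epsilon> \<beta> \<and> (adds_point \<alpha> \<beta> \<or> adds_point \<beta> \<alpha>)"

definition eps_homotopic :: "'a metric \<Rightarrow> real \<Rightarrow> 'a list \<Rightarrow> 'a list \<Rightarrow> bool" where
  "eps_homotopic X \<epsilon> \<alpha> \<beta> \<longleftrightarrow> eps_chain X \<epsilon> \<alpha> \<and> (eps_step X \<epsilon>)\<^sup>*\<^sup>* \<alpha> \<beta>"

definition eps_class :: "'a metric \<Rightarrow> real \<Rightarrow> 'a list \<Rightarrow> 'a list set" where
  "eps_class X \<epsilon> \<alpha> = {\<beta>. eps_homotopic X \<epsilon> \<alpha> \<beta>}"

text \<open>Only used when the last point of the first chain is the first point of the second;
  this common point is then listed once.\<close>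

definition chain_concat :: "'a list \<Rightarrow> 'a list \<Rightarrow> 'a list" where
  "chain_concat \<alpha> \<beta> = \<alpha> @ tl \<beta>"

text \<open>Operations on homotopy classes are defined as unions over all representatives. The
  lemmas \<open>class_concat_class\<close> and \<open>induced_map_class\<close> below show that any choice of
  representatives gives the same class.\<close>

definition class_concat :: "'a metric \<Rightarrow> real \<Rightarrow> 'a list set \<Rightarrow> 'a list set \<Rightarrow> 'a list set" where
  "class_concat X \<epsilon> a b = (\<Union>\<alpha>\<in>a. \<Union>\<beta>\<in>b. eps_class X \<epsilon> (chain_concat \<alpha> \<beta>))"

definition eps_carrier :: "'a metric \<Rightarrow> 'a \<Rightarrow> real \<Rightarrow> 'a list set set" where
  "eps_carrier X p \<epsilon> = {eps_class X \<epsilon> \<alpha> | \<alpha>. eps_chain X \<epsilon> \<alpha> \<and> hd \<alpha> = p}"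

text \<open>Since reversal maps homotopy classes onto homotopy classes, \<open>rev ` a\<close> is the class of the
  reversed chains. The value outside the carrier is immaterial, but the type of metric spaces
  needs a distance that is symmetric and non-negative there as well.\<close>

definition eps_dist :: "'a metric \<Rightarrow> 'a \<Rightarrow> real \<Rightarrow> 'a list set \<Rightarrow> 'a list set \<Rightarrow> real" where
  "eps_dist X p \<epsilon> a b =
     (if a \<in> eps_carrier X p \<epsilon> \<and> b \<in> eps_carrier X p \<epsilon>
      then Inf (chain_length X ` class_concat X \<epsilon> (rev ` a) b) else 0)"

text \<open>The axioms of a metric are checked in \<open>Metric_space_eps\<close> below.\<close>

definition eps_space :: "'a metric \<Rightarrow> 'a \<Rightarrow> real \<Rightarrow> 'a list set metric" where
  "eps_space X p \<epsilon> = metric (eps_carrier X p \<epsilon>, eps_dist X p \<epsilon>)"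

definition eps_group :: "'a metric \<Rightarrow> 'a \<Rightarrow> real \<Rightarrow> 'a list set monoid" where
  "eps_group X p \<epsilon> =
     \<lparr>carrier = {eps_class X \<epsilon> \<alpha> | \<alpha>. eps_chain X \<epsilon> \<alpha> \<and> hd \<alpha> = p \<and> last \<alpha> = p},
      mult = class_concat X \<epsilon>,
      one = eps_class X \<epsilon> [p]\<rparr>"

definition eps_action :: "'a metric \<Rightarrow> real \<Rightarrow> 'a list set \<Rightarrow> 'a list set \<Rightarrow> 'a list set" where
  "eps_action X \<epsilon> g x = class_concat X \<epsilon> g x"

text \<open>The map sending the \<open>\<epsilon>\<close>-class of a chain to its \<open>\<delta>\<close>-class, for \<open>\<delta> \<ge> \<epsilon>\<close>.\<close>

definition phi :: "'a metric \<Rightarrow> real \<Rightarrow> 'a list set \<Rightarrow> 'a list set" where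
  "phi X \<delta> a = (\<Union>\<alpha>\<in>a. eps_class X \<delta> \<alpha>)"

definition induces :: "('a \<Rightarrow> 'b) \<Rightarrow> 'a metric \<Rightarrow> 'a \<Rightarrow> real \<Rightarrow> 'b metric \<Rightarrow> 'b \<Rightarrow> real \<Rightarrow> bool" where
  "induces f X p \<delta> Y q \<epsilon> \<longleftrightarrow>
     f \<in> mspace X \<rightarrow> mspace Y \<and> f p = q \<and>
     (\<forall>x \<in> mspace X. \<forall>y \<in> mspace X. mdist X x y < \<delta> \<longrightarrow> mdist Y (f x) (f y) < \<epsilon>)"

definition induced_map :: "('a \<Rightarrow> 'b) \<Rightarrow> 'b metric \<Rightarrow> real \<Rightarrow> 'a list set \<Rightarrow> 'b list set" where
  "induced_map f Y \<epsilon> a = (\<Union>\<alpha>\<in>a. eps_class Y \<epsilon> (map f \<alpha>))"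

definition induced_hom ::
    "('a \<Rightarrow> 'b) \<Rightarrow> 'a metric \<Rightarrow> 'a \<Rightarrow> real \<Rightarrow> 'b metric \<Rightarrow> real \<Rightarrow> 'a list set \<Rightarrow> 'b list set" where
  "induced_hom f X p \<delta> Y \<epsilon> = restrict (induced_map f Y \<epsilon>) (carrier (eps_group X p \<delta>))"

section \<open>Approximate isometries and pointed Gromov-Hausdorff convergence\<close>

definition sigma_isometry :: "real poly \<Rightarrow> 'a metric \<Rightarrow> 'b metric \<Rightarrow> ('a \<Rightarrow> 'b) \<Rightarrow> bool" where
  "sigma_isometry \<sigma> X Y f \<longleftrightarrow>
     degree \<sigma> \<le> 1 \<and> (\<forall>n. 0 \<le> coeff \<sigma> n) \<and>
     f \<in> mspace X \<rightarrow> mspace Y \<and>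
     (\<forall>x \<in> mspace X. \<forall>y \<in> mspace X.
        \<bar>mdist X x y - mdist Y (f x) (f y)\<bar> \<le> poly \<sigma> (mdist X x y)) \<and>
     (\<forall>z \<in> mspace Y. \<exists>w \<in> mspace X. mdist Y z (f w) \<le> poly \<sigma> 0)"

definition p_poly :: "real \<Rightarrow> real \<Rightarrow> real poly" where
  "p_poly \<sigma> \<epsilon> = [: \<sigma> * (4 * \<sigma> / \<epsilon> + 1), \<sigma> * (4 / \<epsilon> + 16 * \<sigma> / \<epsilon>\<^sup>2) :]"

definition distortion :: "'a metric \<Rightarrow> 'b metric \<Rightarrow> 'a set \<Rightarrow> ('a \<Rightarrow> 'b) \<Rightarrow> ennreal" where
  "distortion X Y S f =
     (SUP x \<in> S. SUP y \<in> S. ennreal \<bar>mdist Y (f x) (f y) - mdist X x y\<bar>)"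

text \<open>The definition for arbitrary metric spaces in Burago, Burago and Ivanov,
  A Course in Metric Geometry, 8.1.1.\<close>

definition pointed_GH_convergent ::
    "(nat \<Rightarrow> 'a metric) \<Rightarrow> (nat \<Rightarrow> 'a) \<Rightarrow> 'b metric \<Rightarrow> 'b \<Rightarrow> bool" where
  "pointed_GH_convergent Xs ps X p \<longleftrightarrow>
     (\<forall>r>0. \<forall>e>0. \<forall>\<^sub>F i in sequentially.
        \<exists>f. f \<in> mball_of (Xs i) (ps i) r \<rightarrow> mspace X \<and> f (ps i) = p \<and>
            distortion (Xs i) X (mball_of (Xs i) (ps i) r) f < ennreal e \<and>
            mball_of X p (r - e) \<subseteq> (\<Union>x \<in> mball_of (Xs i) (ps i) r. mball_of X (f x) e))"

section \<open>Well-definedness\<close>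

lemma eps_step_sym: "eps_step X \<epsilon> \<alpha> \<beta> \<Longrightarrow> eps_step X \<epsilon> \<beta> \<alpha>"
  by (auto simp: eps_step_def)

lemma eps_homotopic_refl: "eps_chain X \<epsilon> \<alpha> \<Longrightarrow> eps_homotopic X \<epsilon> \<alpha> \<alpha>"
  by (simp add: eps_homotopic_def)

lemma eps_homotopic_step: "eps_step X \<epsilon> \<alpha> \<beta> \<Longrightarrow> eps_homotopic X \<epsilon> \<alpha> \<beta>"
  by (auto simp: eps_homotopic_def eps_step_def)

lemma eps_homotopic_induct [consumes 1, case_names refl step]:
  assumes "eps_homotopic X \<epsilon> \<alpha> \<beta>"
    and "P \<alpha>"
    and "\<And>\<beta> \<gamma>. eps_homotopic X \<epsilon> \<alpha> \<beta> \<Longrightarrow> eps_step X \<epsilon> \<beta> \<gamma> \<Longrightarrow> P \<beta> \<Longrightarrow> P \<gamma>"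
  shows "P \<beta>"
proof -
  have "(eps_step X \<epsilon>)\<^sup>*\<^sup>* \<alpha> \<beta>" and "eps_chain X \<epsilon> \<alpha>"
    using assms(1) by (auto simp: eps_homotopic_def)
  then show ?thesis
    by (induction rule: rtranclp_induct) (use assms(2,3) in \<open>auto simp: eps_homotopic_def\<close>)
qed

lemma eps_homotopicD:
  assumes "eps_homotopic X \<epsilon> \<alpha> \<beta>"
  shows "eps_chain X \<epsilon> \<alpha>" "eps_chain X \<epsilon> \<beta>" "hd \<alpha> = hd \<beta>" "last \<alpha> = last \<beta>"
proof -
  show "eps_chain X \<epsilon> \<alpha>" using assms by (simp add: eps_homotopic_def)
  with assms have "eps_chain X \<epsilon> \<beta> \<and> hd \<alpha> = hd \<beta> \<and> last \<alpha> = last \<beta>"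
    by (induction rule: eps_homotopic_induct) (auto simp: eps_step_def adds_point_def)
  then show "eps_chain X \<epsilon> \<beta>" "hd \<alpha> = hd \<beta>" "last \<alpha> = last \<beta>" by auto
qed

lemma eps_homotopic_trans:
  "eps_homotopic X \<epsilon> \<alpha> \<beta> \<Longrightarrow> eps_homotopic X \<epsilon> \<beta> \<gamma> \<Longrightarrow> eps_homotopic X \<epsilon> \<alpha> \<gamma>"
  by (auto simp: eps_homotopic_def)

lemma eps_homotopic_sym:
  assumes "eps_homotopic X \<epsilon> \<alpha> \<beta>" shows "eps_homotopic X \<epsilon> \<beta> \<alpha>"
  using assms
proof (induction rule: eps_homotopic_induct)
  case refl
  then show ?case using assms by (simp add: eps_homotopic_def)
next
  case (step \<beta> \<gamma>)
  then show ?case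
    using eps_homotopic_trans eps_homotopic_step eps_step_sym by blast
qed

lemma eps_class_eq_iff:
  "eps_chain X \<epsilon> \<alpha> \<Longrightarrow> eps_class X \<epsilon> \<alpha> = eps_class X \<epsilon> \<beta> \<longleftrightarrow> eps_homotopic X \<epsilon> \<alpha> \<beta>"
  unfolding eps_class_def set_eq_iff mem_Collect_eq
  by (meson eps_homotopic_refl eps_homotopic_sym eps_homotopic_trans)

lemma eps_homotopic_lift:
  assumes "eps_homotopic X \<epsilon> \<alpha> \<beta>"
    and F: "\<And>\<beta> \<gamma>. eps_homotopic X \<epsilon> \<alpha> \<beta> \<Longrightarrow> eps_step X \<epsilon> \<beta> \<gamma> \<Longrightarrow> eps_step Y \<delta> (F \<beta>) (F \<gamma>)"
    and "eps_chain Y \<delta> (F \<alpha>)"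
  shows "eps_homotopic Y \<delta> (F \<alpha>) (F \<beta>)"
  using assms(1)
proof (induction rule: eps_homotopic_induct)
  case refl
  then show ?case using assms(3) by (rule eps_homotopic_refl)
next
  case (step \<beta> \<gamma>)
  then show ?case using F eps_homotopic_step eps_homotopic_trans by blast
qed

lemma chain_concat_simps:
  assumes "\<alpha> \<noteq> []" "\<beta> \<noteq> []" "last \<alpha> = hd \<beta>"
  shows "hd (chain_concat \<alpha> \<beta>) = hd \<alpha>" "last (chain_concat \<alpha> \<beta>) = last \<beta>"
    "chain_concat \<alpha> \<beta> = butlast \<alpha> @ \<beta>"
proof -
  show "hd (chain_concat \<alpha> \<beta>) = hd \<alpha>"
    using assms by (simp add: chain_concat_def)
  show *: "chain_concat \<alpha> \<beta> = butlast \<alpha> @ \<beta>"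
    using assms by (metis append.assoc append_Cons append_Nil append_butlast_last_id
        chain_concat_def list.collapse)
  show "last (chain_concat \<alpha> \<beta>) = last \<beta>"
    using assms by (simp add: *)
qed

lemma eps_chain_concat:
  assumes "eps_chain X \<epsilon> \<alpha>" "eps_chain X \<epsilon> \<beta>" "last \<alpha> = hd \<beta>"
  shows "eps_chain X \<epsilon> (chain_concat \<alpha> \<beta>)"
  using assms unfolding eps_chain_def chain_concat_def
  by (cases \<beta>) (auto simp: successively_append_iff successively_Cons)

lemma adds_point_concat_left:
  assumes "adds_point \<alpha> \<alpha>'" "\<alpha> \<noteq> []" "\<beta> \<noteq> []" "last \<alpha> = hd \<beta>"
  shows "adds_point (chain_concat \<alpha> \<beta>) (chain_concat \<alpha>' \<beta>)"
proof -
  obtain xs z ys where *: "\<alpha> = xs @ ys" "\<alpha>' = xs @ z # ys"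
    using assms by (auto simp: adds_point_def)
  have "chain_concat \<alpha> \<beta> = xs @ (ys @ tl \<beta>)" "chain_concat \<alpha>' \<beta> = xs @ z # (ys @ tl \<beta>)"
    using * by (auto simp: chain_concat_def)
  moreover have "\<alpha>' \<noteq> []" using * by auto
  ultimately show ?thesis
    using assms unfolding adds_point_def by (metis chain_concat_simps(1,2))
qed

lemma adds_point_concat_right:
  assumes "adds_point \<beta> \<beta>'" "\<alpha> \<noteq> []" "\<beta> \<noteq> []" "last \<alpha> = hd \<beta>"
  shows "adds_point (chain_concat \<alpha> \<beta>) (chain_concat \<alpha> \<beta>')"
proof -
  obtain xs z ys where *: "\<beta> = xs @ ys" "\<beta>' = xs @ z # ys"
    using assms by (auto simp: adds_point_def)
  have ne: "\<beta>' \<noteq> []" using * by auto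
  have eq: "last \<alpha> = hd \<beta>'" using assms by (simp add: adds_point_def)
  have "chain_concat \<alpha> \<beta> = (butlast \<alpha> @ xs) @ ys" "chain_concat \<alpha> \<beta>' = (butlast \<alpha> @ xs) @ z # ys"
    using chain_concat_simps(3)[OF assms(2) assms(3) assms(4)]
      chain_concat_simps(3)[OF assms(2) ne eq] * by simp_all
  then show ?thesis
    using assms ne eq unfolding adds_point_def by (metis chain_concat_simps(1,2))
qed

lemma eps_homotopic_concat:
  assumes a: "eps_homotopic X \<epsilon> \<alpha> \<alpha>'" and b: "eps_homotopic X \<epsilon> \<beta> \<beta>'" and e: "last \<alpha> = hd \<beta>"
  shows "eps_homotopic X \<epsilon> (chain_concat \<alpha> \<beta>) (chain_concat \<alpha>' \<beta>')"
proof (rule eps_homotopic_trans)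
  note ca = eps_homotopicD[OF a] and cb = eps_homotopicD[OF b]
  show "eps_homotopic X \<epsilon> (chain_concat \<alpha> \<beta>) (chain_concat \<alpha>' \<beta>)"
  proof (rule eps_homotopic_lift[OF a])
    fix \<gamma> \<gamma>' assume h: "eps_homotopic X \<epsilon> \<alpha> \<gamma>" and s: "eps_step X \<epsilon> \<gamma> \<gamma>'"
    have "last \<gamma> = hd \<beta>" "last \<gamma>' = hd \<beta>"
      using eps_homotopicD[OF h] eps_homotopicD[OF eps_homotopic_step[OF s]] e by auto
    then show "eps_step X \<epsilon> (chain_concat \<gamma> \<beta>) (chain_concat \<gamma>' \<beta>)"
      using s cb(1) unfolding eps_step_def
      by (metis adds_point_concat_left eps_chain_concat eps_chain_def)
  qed (use ca cb e in \<open>auto intro: eps_chain_concat\<close>)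
  show "eps_homotopic X \<epsilon> (chain_concat \<alpha>' \<beta>) (chain_concat \<alpha>' \<beta>')"
  proof (rule eps_homotopic_lift[OF b])
    fix \<gamma> \<gamma>' assume h: "eps_homotopic X \<epsilon> \<beta> \<gamma>" and s: "eps_step X \<epsilon> \<gamma> \<gamma>'"
    have "last \<alpha>' = hd \<gamma>" "last \<alpha>' = hd \<gamma>'"
      using eps_homotopicD[OF h] eps_homotopicD[OF eps_homotopic_step[OF s]] e ca by auto
    then show "eps_step X \<epsilon> (chain_concat \<alpha>' \<gamma>) (chain_concat \<alpha>' \<gamma>')"
      using s ca(2) unfolding eps_step_def
      by (metis adds_point_concat_right eps_chain_concat eps_chain_def)
  qed (use ca cb e in \<open>auto intro: eps_chain_concat\<close>)
qed

lemma class_concat_class: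
  assumes "eps_chain X \<epsilon> \<alpha>" "eps_chain X \<epsilon> \<beta>" "last \<alpha> = hd \<beta>"
  shows "class_concat X \<epsilon> (eps_class X \<epsilon> \<alpha>) (eps_class X \<epsilon> \<beta>) = eps_class X \<epsilon> (chain_concat \<alpha> \<beta>)"
proof -
  have "eps_class X \<epsilon> (chain_concat \<alpha>' \<beta>') = eps_class X \<epsilon> (chain_concat \<alpha> \<beta>)"
    if "\<alpha>' \<in> eps_class X \<epsilon> \<alpha>" "\<beta>' \<in> eps_class X \<epsilon> \<beta>" for \<alpha>' \<beta>'
    using that assms eps_class_eq_iff eps_homotopic_concat eps_chain_concat
    by (metis eps_class_def mem_Collect_eq)
  moreover have "\<alpha> \<in> eps_class X \<epsilon> \<alpha>" "\<beta> \<in> eps_class X \<epsilon> \<beta>"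
    using assms by (auto simp: eps_class_def eps_homotopic_refl)
  ultimately show ?thesis unfolding class_concat_def by blast
qed

lemma eps_chain_rev: "eps_chain X \<epsilon> \<alpha> \<Longrightarrow> eps_chain X \<epsilon> (rev \<alpha>)"
  by (simp add: eps_chain_def mdist_commute)

lemma adds_point_rev: 
  assumes "adds_point \<alpha> \<beta>" "\<alpha> \<noteq> []" shows "adds_point (rev \<alpha>) (rev \<beta>)"
proof -
  obtain xs z ys where *: "\<alpha> = xs @ ys" "\<beta> = xs @ z # ys"
    using assms by (auto simp: adds_point_def)
  then have "rev \<alpha> = rev ys @ rev xs" "rev \<beta> = rev ys @ z # rev xs" by auto
  moreover have "\<beta> \<noteq> []" using * by simp
  ultimately show ?thesis
    using assms unfolding adds_point_def by (metis hd_rev last_rev)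
qed

lemma eps_homotopic_rev:
  assumes "eps_homotopic X \<epsilon> \<alpha> \<beta>" shows "eps_homotopic X \<epsilon> (rev \<alpha>) (rev \<beta>)"
proof (rule eps_homotopic_lift[OF assms])
  show "eps_step X \<epsilon> (rev \<beta>) (rev \<gamma>)" if "eps_step X \<epsilon> \<beta> \<gamma>" for \<beta> \<gamma>
    using that unfolding eps_step_def
    by (metis adds_point_rev eps_chain_rev eps_chain_def)
qed (use assms eps_chain_rev eps_homotopicD in blast)

lemma rev_eps_class: "rev ` eps_class X \<epsilon> \<alpha> = eps_class X \<epsilon> (rev \<alpha>)"
  unfolding eps_class_def image_def
  by (auto dest: eps_homotopic_rev) (metis eps_homotopic_rev rev_rev_ident)

lemma eps_homotopic_map:
  assumes f: "f \<in> mspace X \<rightarrow> mspace Y"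
    "\<forall>x \<in> mspace X. \<forall>y \<in> mspace X. mdist X x y < \<delta> \<longrightarrow> mdist Y (f x) (f y) < \<epsilon>"
    and h: "eps_homotopic X \<delta> \<alpha> \<beta>"
  shows "eps_homotopic Y \<epsilon> (map f \<alpha>) (map f \<beta>)"
proof -
  have c: "eps_chain Y \<epsilon> (map f \<gamma>)" if "eps_chain X \<delta> \<gamma>" for \<gamma>
  proof -
    have s: "set \<gamma> \<subseteq> mspace X" "\<gamma> \<noteq> []" "successively (\<lambda>x y. mdist X x y < \<delta>) \<gamma>"
      using that by (auto simp: eps_chain_def)
    have "successively (\<lambda>x y. mdist Y (f x) (f y) < \<epsilon>) \<gamma>"
      by (rule successively_mono[OF s(3)]) (use f(2) s(1) in blast)
    then show ?thesis using s f(1) by (auto simp: eps_chain_def successively_map)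
  qed
  have ad: "adds_point (map f \<gamma>) (map f \<gamma>')" if ap: "adds_point \<gamma> \<gamma>'" "\<gamma> \<noteq> []" for \<gamma> \<gamma>'
  proof -
    obtain xs z ys where *: "\<gamma> = xs @ ys" "\<gamma>' = xs @ z # ys"
      using ap(1) by (auto simp: adds_point_def)
    then have "map f \<gamma> = map f xs @ map f ys" "map f \<gamma>' = map f xs @ f z # map f ys" by auto
    moreover have "\<gamma>' \<noteq> []" using * by simp
    ultimately show ?thesis
      using ap unfolding adds_point_def by (metis hd_map last_map)
  qed
  show ?thesis
  proof (rule eps_homotopic_lift[OF h])
    show "eps_step Y \<epsilon> (map f \<beta>) (map f \<gamma>)" if "eps_step X \<delta> \<beta> \<gamma>" for \<beta> \<gamma>
      using that ad c unfolding eps_step_def by (metis eps_chain_def)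
  qed (use h c eps_homotopicD in blast)
qed

lemma induced_map_class:
  assumes f: "induces f X p \<delta> Y q \<epsilon>" and \<alpha>: "eps_chain X \<delta> \<alpha>"
  shows "induced_map f Y \<epsilon> (eps_class X \<delta> \<alpha>) = eps_class Y \<epsilon> (map f \<alpha>)"
proof -
  have "eps_class Y \<epsilon> (map f \<beta>) = eps_class Y \<epsilon> (map f \<alpha>)" if "\<beta> \<in> eps_class X \<delta> \<alpha>" for \<beta>
  proof -
    have "eps_homotopic Y \<epsilon> (map f \<alpha>) (map f \<beta>)"
      using f that eps_homotopic_map unfolding induces_def eps_class_def by blast
    then show ?thesis using eps_class_eq_iff eps_homotopicD(1) by metis
  qed
  moreover have "\<alpha> \<in> eps_class X \<delta> \<alpha>"
    using \<alpha> by (simp add: eps_class_def eps_homotopic_refl)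
  ultimately show ?thesis unfolding induced_map_def by blast
qed

lemma phi_class:
  assumes "\<epsilon> \<le> \<delta>" "eps_chain X \<epsilon> \<alpha>"
  shows "phi X \<delta> (eps_class X \<epsilon> \<alpha>) = eps_class X \<delta> \<alpha>"
  using induced_map_class[of "\<lambda>x. x" X "undefined" \<epsilon> X "undefined" \<delta> \<alpha>] assms
  by (auto simp: phi_def induced_map_def induces_def)

section \<open>The metric\<close>

lemma chain_length_nonneg: "0 \<le> chain_length X \<alpha>"
  by (induction X \<alpha> rule: chain_length.induct) auto

lemma chain_length_append:
  "chain_length X (xs @ z # ys) = chain_length X (xs @ [z]) + chain_length X (z # ys)"
  by (induction X xs rule: chain_length.induct) auto

lemma chain_length_concat:
  assumes "\<alpha> \<noteq> []" "\<beta> \<noteq> []" "last \<alpha> = hd \<beta>"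
  shows "chain_length X (chain_concat \<alpha> \<beta>) = chain_length X \<alpha> + chain_length X \<beta>"
proof -
  have "chain_concat \<alpha> \<beta> = butlast \<alpha> @ hd \<beta> # tl \<beta>"
    using chain_concat_simps(3)[OF assms] assms by simp
  moreover have "butlast \<alpha> @ [hd \<beta>] = \<alpha>" "hd \<beta> # tl \<beta> = \<beta>"
    using assms append_butlast_last_id by (metis, simp)
  ultimately show ?thesis
    using chain_length_append[of X "butlast \<alpha>" "hd \<beta>" "tl \<beta>"] by simp
qed

lemma chain_length_rev: "chain_length X (rev \<alpha>) = chain_length X \<alpha>"
proof (induction X \<alpha> rule: chain_length.induct)
  case (1 X x y xs)
  then show ?case
    using chain_length_append[of X "rev xs" y "[x]"] by (simp add: mdist_commute)
qed auto

lemma mdist_self [simp]: "x \<in> mspace X \<Longrightarrow> mdist X x x = 0"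
  by simp

lemma mdist_le_chain_length:
  "set (x # xs) \<subseteq> mspace X \<Longrightarrow> mdist X x (last (x # xs)) \<le> chain_length X (x # xs)"
proof (induction xs arbitrary: x)
  case (Cons y xs)
  have "last (y # xs) \<in> mspace X" using Cons.prems last_in_set[of "y # xs"] by auto
  then have "mdist X x (last (y # xs)) \<le> mdist X x y + mdist X y (last (y # xs))"
    using Cons.prems by (intro mdist_triangle) auto
  then show ?case using Cons by fastforce
qed auto

lemma short_chain:
  assumes "eps_chain X \<epsilon> (x # xs)" "xs \<noteq> []" "chain_length X (x # xs) < \<epsilon>"
  shows "eps_homotopic X \<epsilon> (x # xs) [x, last xs]"
  using assms
proof (induction xs)
  case (Cons y ys)
  show ?case
  proof (cases ys)
    case Nil
    then show ?thesis using Cons.prems by (simp add: eps_homotopic_refl)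
  next
    case (Cons z zs)
    have sub: "{x, y, z} \<subseteq> mspace X" using Cons.prems(1) Cons by (auto simp: eps_chain_def)
    then have tri: "mdist X x z \<le> mdist X x y + mdist X y z" by (intro mdist_triangle) auto
    have len: "chain_length X (x # ys) \<le> chain_length X (x # y # ys)"
      using Cons tri by simp
    have "mdist X x z < \<epsilon>"
      using Cons.prems(3) Cons tri chain_length_nonneg[of X "z # zs"] by simp
    then have c: "eps_chain X \<epsilon> (x # ys)"
      using Cons.prems(1) Cons by (auto simp: eps_chain_def)
    have "adds_point (x # ys) (x # y # ys)"
      unfolding adds_point_def using Cons
      by (intro conjI exI[of _ "[x]"] exI[of _ y] exI[of _ ys]) auto
    then have "eps_step X \<epsilon> (x # y # ys) (x # ys)"
      using c Cons.prems(1) by (simp add: eps_step_def)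
    moreover have "eps_homotopic X \<epsilon> (x # ys) [x, last ys]"
      using Cons.IH c len Cons.prems(3) Cons by simp
    ultimately show ?thesis
      using eps_homotopic_step eps_homotopic_trans Cons by fastforce
  qed
qed simp

lemma eps_homotopic_double:
  assumes "x \<in> mspace X" "0 < \<epsilon>" shows "eps_homotopic X \<epsilon> [x, x] [x]"
proof -
  have "adds_point [x] [x, x]"
    unfolding adds_point_def by (auto intro!: exI[of _ "[x]"])
  then show ?thesis
    using assms by (intro eps_homotopic_step) (auto simp: eps_step_def eps_chain_def)
qed

lemma short_loop:
  assumes "eps_chain X \<epsilon> \<gamma>" "hd \<gamma> = last \<gamma>" "chain_length X \<gamma> < \<epsilon>" "0 < \<epsilon>"
  shows "eps_homotopic X \<epsilon> \<gamma> [hd \<gamma>]"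
proof -
  obtain x xs where \<gamma>: "\<gamma> = x # xs"
    using assms(1) by (cases \<gamma>) (auto simp: eps_chain_def)
  show ?thesis
  proof (cases "xs = []")
    case True
    then show ?thesis using assms(1) \<gamma> by (simp add: eps_homotopic_refl)
  next
    case False
    then have "last xs = x" using assms(2) \<gamma> by simp
    then have "eps_homotopic X \<epsilon> \<gamma> [x, x]"
      using short_chain[of X \<epsilon> x xs] False assms(1,3) \<gamma> by simp
    moreover have "eps_homotopic X \<epsilon> [x, x] [x]"
      using assms(1,4) \<gamma> by (intro eps_homotopic_double) (auto simp: eps_chain_def)
    ultimately show ?thesis using \<gamma> eps_homotopic_trans by fastforce
  qed
qed

lemma eps_homotopic_rev_concat:
  assumes "eps_chain X \<epsilon> \<alpha>" "0 < \<epsilon>"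
  shows "eps_homotopic X \<epsilon> (chain_concat (rev \<alpha>) \<alpha>) [last \<alpha>]"
  using assms(1)
proof (induction \<alpha> rule: induct_list012)
  case 1
  then show ?case by (simp add: eps_chain_def)
next
  case (2 x)
  then show ?case by (simp add: chain_concat_def eps_homotopic_refl)
next
  case (3 x y ys)
  have c: "eps_chain X \<epsilon> (y # ys)" and x: "x \<in> mspace X" "mdist X x y < \<epsilon>"
    using 3(3) by (auto simp: eps_chain_def)
  have y: "y \<in> mspace X" using c by (simp add: eps_chain_def)
  let ?r = "rev ys" 
  have c2: "eps_chain X \<epsilon> (chain_concat (rev (y # ys)) (y # ys))"
    using c by (intro eps_chain_concat eps_chain_rev) auto
  then have ch1: "eps_chain X \<epsilon> (?r @ [y] @ ys)" by (simp add: chain_concat_def)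
  have ch2: "eps_chain X \<epsilon> (?r @ [y] @ [y] @ ys)" and ch3: "eps_chain X \<epsilon> (?r @ [y] @ [x, y] @ ys)"
    using ch1 x y assms(2)
    by (auto simp: eps_chain_def successively_append_iff successively_Cons mdist_commute)
  have hd3: "hd (?r @ [y] @ zs) = hd (?r @ [y])" for zs
    by (cases ys rule: rev_cases) auto
  have last3: "last (?r @ [y] @ zs @ y # ys) = last (?r @ [y] @ ys)" for zs
    by auto
  have "adds_point (?r @ [y] @ ys) (?r @ [y] @ [y] @ ys)"
    unfolding adds_point_def
  proof (intro conjI)
    show "\<exists>xs z zs. rev ys @ [y] @ ys = xs @ zs \<and> rev ys @ [y] @ [y] @ ys = xs @ z # zs"
      by (intro exI[of _ "?r @ [y]"]) auto
  qed (use hd3[of ys] hd3[of "[y] @ ys"] last3[of "[]"] in auto)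
  moreover have "adds_point (?r @ [y] @ [y] @ ys) (?r @ [y] @ [x, y] @ ys)"
    unfolding adds_point_def
  proof (intro conjI)
    show "\<exists>xs z zs. rev ys @ [y] @ [y] @ ys = xs @ zs \<and> rev ys @ [y] @ [x, y] @ ys = xs @ z # zs"
      by (intro exI[of _ "?r @ [y]"] exI[of _ x] exI[of _ "y # ys"]) auto
  qed (use hd3[of "[y] @ ys"] hd3[of "[x, y] @ ys"] in auto)
  ultimately have "eps_homotopic X \<epsilon> (?r @ [y] @ [x, y] @ ys) (?r @ [y] @ ys)"
    using ch1 ch2 ch3 eps_homotopic_trans[OF eps_homotopic_step eps_homotopic_step]
    unfolding eps_step_def by blast
  moreover have "eps_homotopic X \<epsilon> (?r @ [y] @ ys) [last (y # ys)]"
    using 3(2)[OF c] by (simp add: chain_concat_def)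
  ultimately show ?case
    using eps_homotopic_trans by (fastforce simp: chain_concat_def)
qed

lemma chain_concat_assoc: 
  "\<beta> \<noteq> [] \<Longrightarrow> chain_concat (chain_concat \<alpha> \<beta>) \<gamma> = chain_concat \<alpha> (chain_concat \<beta> \<gamma>)"
  by (simp add: chain_concat_def)

lemma chain_concat_single [simp]: "chain_concat \<alpha> [x] = \<alpha>"
  "chain_concat [x] \<alpha> = x # tl \<alpha>"
  by (simp_all add: chain_concat_def)

lemma eps_homotopic_concat_rev:
  assumes "eps_chain X \<epsilon> \<alpha>" "0 < \<epsilon>"
  shows "eps_homotopic X \<epsilon> (chain_concat \<alpha> (rev \<alpha>)) [hd \<alpha>]"
  using eps_homotopic_rev_concat[OF eps_chain_rev[OF assms(1)] assms(2)] assms(1)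
  by (simp add: last_rev eps_chain_def)

lemma eps_carrier_cases:
  assumes "a \<in> eps_carrier X p \<epsilon>"
  obtains \<alpha> where "a = eps_class X \<epsilon> \<alpha>" "eps_chain X \<epsilon> \<alpha>" "hd \<alpha> = p"
  using assms by (auto simp: eps_carrier_def)

lemma eps_dist_class:
  assumes "eps_chain X \<epsilon> \<alpha>" "hd \<alpha> = p" "eps_chain X \<epsilon> \<beta>" "hd \<beta> = p"
  shows "eps_dist X p \<epsilon> (eps_class X \<epsilon> \<alpha>) (eps_class X \<epsilon> \<beta>) =
    Inf (chain_length X ` eps_class X \<epsilon> (chain_concat (rev \<alpha>) \<beta>))"
proof -
  have "last (rev \<alpha>) = hd \<beta>" using assms by (simp add: eps_chain_def last_rev)
  then show ?thesis
    using assms class_concat_class[OF eps_chain_rev[OF assms(1)] assms(3)]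
    by (auto simp: eps_dist_def eps_carrier_def rev_eps_class)
qed

lemma Metric_space_eps:
  assumes "0 < \<epsilon>"
  shows "Metric_space (eps_carrier X p \<epsilon>) (eps_dist X p \<epsilon>)"
proof
  let ?d = "eps_dist X p \<epsilon>" and ?L = "chain_length X" and ?C = "eps_class X \<epsilon>"
  have bdd: "bdd_below (?L ` A)" for A
    using chain_length_nonneg by (intro bdd_belowI[of _ 0]) auto
  have ch: "eps_chain X \<epsilon> (chain_concat (rev \<alpha>) \<beta>)" 
    if "eps_chain X \<epsilon> \<alpha>" "eps_chain X \<epsilon> \<beta>" "hd \<alpha> = p" "hd \<beta> = p" for \<alpha> \<beta>
    using that by (intro eps_chain_concat eps_chain_rev) (auto simp: eps_chain_def last_rev)
  have ne: "?C \<alpha> \<noteq> {}" if "eps_chain X \<epsilon> \<alpha>" for \<alpha>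
    using that eps_homotopic_refl by (auto simp: eps_class_def)
  show nonneg: "0 \<le> ?d a b" for a b
  proof (cases "a \<in> eps_carrier X p \<epsilon> \<and> b \<in> eps_carrier X p \<epsilon>")
    case True
    then obtain \<alpha> \<beta> where "a = ?C \<alpha>" "eps_chain X \<epsilon> \<alpha>" "hd \<alpha> = p" "b = ?C \<beta>" "eps_chain X \<epsilon> \<beta>" "hd \<beta> = p"
      by (metis eps_carrier_cases)
    then show ?thesis
      using ne ch by (simp add: eps_dist_class) (intro cINF_greatest chain_length_nonneg, auto)
  qed (auto simp: eps_dist_def)
  show commute: "?d a b = ?d b a" for a b
  proof (cases "a \<in> eps_carrier X p \<epsilon> \<and> b \<in> eps_carrier X p \<epsilon>")
    case True
    then obtain \<alpha> \<beta> where *: "a = ?C \<alpha>" "eps_chain X \<epsilon> \<alpha>" "hd \<alpha> = p" "b = ?C \<beta>" "eps_chain X \<epsilon> \<beta>" "hd \<beta> = p"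
      by (metis eps_carrier_cases)
    have "rev (chain_concat (rev \<alpha>) \<beta>) = chain_concat (rev \<beta>) \<alpha>"
      using * by (cases \<alpha>; cases \<beta>) (auto simp: chain_concat_def eps_chain_def)
    then have "?C (chain_concat (rev \<beta>) \<alpha>) = rev ` ?C (chain_concat (rev \<alpha>) \<beta>)"
      by (simp add: rev_eps_class)
    then show ?thesis
      using * by (simp add: eps_dist_class image_image chain_length_rev)
  qed (auto simp: eps_dist_def)
  show "?d a b = 0 \<longleftrightarrow> a = b" if ab: "a \<in> eps_carrier X p \<epsilon>" "b \<in> eps_carrier X p \<epsilon>" for a b
  proof -
    obtain \<alpha> \<beta> where *: "a = ?C \<alpha>" "eps_chain X \<epsilon> \<alpha>" "hd \<alpha> = p" "b = ?C \<beta>" "eps_chain X \<epsilon> \<beta>" "hd \<beta> = p"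
      using ab by (metis eps_carrier_cases)
    have e: "last (rev \<alpha>) = hd \<beta>" "last \<alpha> = hd (rev \<alpha>)" "\<alpha> \<noteq> []" "\<beta> \<noteq> []"
      using * by (auto simp: eps_chain_def last_rev hd_rev)
    let ?\<zeta> = "chain_concat (rev \<alpha>) \<beta>"
    have hz: "hd ?\<zeta> = last \<alpha>"
      using chain_concat_simps(1)[OF _ e(4,1)] e(2,3) by simp
    have d: "?d a b = Inf (?L ` ?C ?\<zeta>)" using * eps_dist_class by simp
    show ?thesis
    proof
      assume 0: "?d a b = 0"
      then have "Inf (?L ` ?C ?\<zeta>) < \<epsilon>" using d assms by simp
      then obtain \<gamma> where \<gamma>: "\<gamma> \<in> ?C ?\<zeta>" "?L \<gamma> < \<epsilon>"
        using ne ch * cInf_lessD[of "?L ` ?C ?\<zeta>" \<epsilon>] by auto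
      have h: "eps_homotopic X \<epsilon> ?\<zeta> \<gamma>" using \<gamma> by (simp add: eps_class_def)
      have lin: "last \<alpha> \<in> mspace X" "last \<beta> \<in> mspace X"
        using * e(3,4) last_in_set unfolding eps_chain_def by blast+
      have "mdist X (last \<alpha>) (last \<beta>) \<le> ?L \<gamma>'" if "\<gamma>' \<in> ?C ?\<zeta>" for \<gamma>'
      proof -
        have h': "eps_homotopic X \<epsilon> ?\<zeta> \<gamma>'" using that by (simp add: eps_class_def)
        have g: "hd \<gamma>' = last \<alpha>" "last \<gamma>' = last \<beta>" "\<gamma>' \<noteq> []" "set \<gamma>' \<subseteq> mspace X"
          using eps_homotopicD[OF h'] chain_concat_simps[OF _ e(4,1)] e
          by (auto simp: eps_chain_def)
        then show ?thesis using mdist_le_chain_length[of "hd \<gamma>'" "tl \<gamma>'" X] list.collapse[of "\<gamma>'"] by metis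
      qed
      then have "mdist X (last \<alpha>) (last \<beta>) \<le> 0"
        using 0 d ne ch * by (metis cINF_greatest)
      then have eq: "last \<alpha> = last \<beta>"
        using lin by (metis mdist_nonneg mdist_zero order_antisym)
      have g: "hd \<gamma> = last \<alpha>" "last \<gamma> = last \<alpha>" "\<gamma> \<noteq> []" "eps_chain X \<epsilon> \<gamma>"
        using eps_homotopicD[OF h] chain_concat_simps[OF _ e(4,1)] e eq
        by (auto simp: eps_chain_def)
      have "eps_homotopic X \<epsilon> \<gamma> [last \<alpha>]"
        using short_loop[OF g(4) _ \<gamma>(2) assms] g(1,2) by simp
      then have "eps_homotopic X \<epsilon> ?\<zeta> [last \<alpha>]"
        using h eps_homotopic_trans by blast
      then have "eps_homotopic X \<epsilon> (chain_concat \<alpha> ?\<zeta>) (chain_concat \<alpha> [last \<alpha>])"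
        using hz by (intro eps_homotopic_concat eps_homotopic_refl *) simp_all
      then have 1: "eps_homotopic X \<epsilon> (chain_concat \<alpha> ?\<zeta>) \<alpha>" by simp
      have "eps_homotopic X \<epsilon> (chain_concat (chain_concat \<alpha> (rev \<alpha>)) \<beta>) (chain_concat [hd \<alpha>] \<beta>)"
        using e * eps_homotopic_concat_rev[OF *(2) assms]
        by (intro eps_homotopic_concat eps_homotopic_refl) (auto simp: chain_concat_simps(1,2))
      moreover have "chain_concat [hd \<alpha>] \<beta> = \<beta>" using * e by (metis chain_concat_single(2) list.collapse)
      ultimately have "eps_homotopic X \<epsilon> (chain_concat \<alpha> ?\<zeta>) \<beta>"
        using e by (simp add: chain_concat_assoc)
      then have "eps_homotopic X \<epsilon> \<alpha> \<beta>"
        using 1 eps_homotopic_sym eps_homotopic_trans by blast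
      then show "a = b" using * eps_class_eq_iff by metis
    next
      assume "a = b"
      then have "eps_homotopic X \<epsilon> \<alpha> \<beta>" using * eps_class_eq_iff by metis
      then have "eps_homotopic X \<epsilon> ?\<zeta> (chain_concat (rev \<alpha>) \<alpha>)"
        using e(1) * by (intro eps_homotopic_concat eps_homotopic_refl eps_chain_rev)
          (auto intro: eps_homotopic_sym)
      then have "[last \<alpha>] \<in> ?C ?\<zeta>"
        using eps_homotopic_rev_concat[OF *(2) assms] eps_homotopic_trans
        unfolding eps_class_def by blast
      then have "?d a b \<le> ?L [last \<alpha>]"
        unfolding d by (intro cINF_lower bdd)
      then show "?d a b = 0" using nonneg[of a b] by simp
    qed
  qed
  show "?d a c \<le> ?d a b + ?d b c"
    if abc: "a \<in> eps_carrier X p \<epsilon>" "b \<in> eps_carrier X p \<epsilon>" "c \<in> eps_carrier X p \<epsilon>" for a b c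
  proof -
    obtain \<alpha> \<beta> \<gamma> where *: "a = ?C \<alpha>" "eps_chain X \<epsilon> \<alpha>" "hd \<alpha> = p" "b = ?C \<beta>" "eps_chain X \<epsilon> \<beta>" "hd \<beta> = p"
      "c = ?C \<gamma>" "eps_chain X \<epsilon> \<gamma>" "hd \<gamma> = p"
      using abc by (metis eps_carrier_cases)
    have nn: "\<alpha> \<noteq> []" "\<beta> \<noteq> []" "\<gamma> \<noteq> []" using * by (auto simp: eps_chain_def)
    let ?ab = "chain_concat (rev \<alpha>) \<beta>" and ?bc = "chain_concat (rev \<beta>) \<gamma>"
      and ?ac = "chain_concat (rev \<alpha>) \<gamma>"
    have ends: "hd ?ab = last \<alpha>" "last ?ab = last \<beta>" "hd ?bc = last \<beta>" "last ?bc = last \<gamma>"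
      using * nn by (simp_all add: chain_concat_simps(1,2) last_rev hd_rev)
    have key: "?d a c \<le> ?L \<xi> + ?L \<eta>" if "\<xi> \<in> ?C ?ab" "\<eta> \<in> ?C ?bc" for \<xi> \<eta>
    proof -
      have h: "eps_homotopic X \<epsilon> ?ab \<xi>" "eps_homotopic X \<epsilon> ?bc \<eta>"
        using that by (auto simp: eps_class_def)
      have "last \<xi> = hd \<eta>" "\<xi> \<noteq> []" "\<eta> \<noteq> []"
        using eps_homotopicD[OF h(1)] eps_homotopicD[OF h(2)] ends by (auto simp: eps_chain_def)
      then have L: "?L (chain_concat \<xi> \<eta>) = ?L \<xi> + ?L \<eta>" by (intro chain_length_concat) auto
      have 1: "eps_homotopic X \<epsilon> (chain_concat ?ab ?bc) (chain_concat \<xi> \<eta>)"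
        using h ends by (intro eps_homotopic_concat) auto
      have "chain_concat \<beta> ?bc = chain_concat (chain_concat \<beta> (rev \<beta>)) \<gamma>"
        using nn by (simp add: chain_concat_assoc)
      moreover have "eps_homotopic X \<epsilon> (chain_concat (chain_concat \<beta> (rev \<beta>)) \<gamma>) (chain_concat [hd \<beta>] \<gamma>)"
        using nn * eps_homotopic_concat_rev[OF *(5) assms]
        by (intro eps_homotopic_concat eps_homotopic_refl) (auto simp: chain_concat_simps(1,2) hd_rev last_rev)
      moreover have "chain_concat [hd \<beta>] \<gamma> = \<gamma>" using * nn by (metis chain_concat_single(2) list.collapse)
      ultimately have h2: "eps_homotopic X \<epsilon> (chain_concat \<beta> ?bc) \<gamma>" by simp
      then have "eps_homotopic X \<epsilon> (chain_concat (rev \<alpha>) (chain_concat \<beta> ?bc)) ?ac"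
        using nn * eps_homotopicD(3)[OF h2]
        by (intro eps_homotopic_concat eps_homotopic_refl eps_chain_rev) (simp_all add: last_rev)
      then have "eps_homotopic X \<epsilon> (chain_concat ?ab ?bc) ?ac"
        using nn by (simp add: chain_concat_assoc)
      then have "chain_concat \<xi> \<eta> \<in> ?C ?ac"
        using 1 eps_homotopic_sym eps_homotopic_trans unfolding eps_class_def by blast
      then have "?d a c \<le> ?L (chain_concat \<xi> \<eta>)"
        using * by (simp add: eps_dist_class) (intro cINF_lower bdd)
      then show ?thesis using L by simp
    qed
    have "?d a c - ?L \<eta> \<le> ?d a b" if "\<eta> \<in> ?C ?bc" for \<eta>
    proof -
      have "?d a c - ?L \<eta> \<le> Inf (?L ` ?C ?ab)"
        using key[OF _ that] ne ch * by (intro cINF_greatest) (auto simp: algebra_simps)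
      then show ?thesis using * by (simp add: eps_dist_class)
    qed
    then have "?d a c - ?d a b \<le> Inf (?L ` ?C ?bc)"
      using ne ch * by (intro cINF_greatest) (auto simp: algebra_simps)
    then show ?thesis using * by (simp add: eps_dist_class)
  qed
qed

lemma mspace_eps_space: "0 < \<epsilon> \<Longrightarrow> mspace (eps_space X p \<epsilon>) = eps_carrier X p \<epsilon>"
  and mdist_eps_space: "0 < \<epsilon> \<Longrightarrow> mdist (eps_space X p \<epsilon>) = eps_dist X p \<epsilon>"
  unfolding eps_space_def
  by (simp_all add: Metric_space.mspace_metric Metric_space.mdist_metric Metric_space_eps)

section \<open>The group\<close>

lemma eps_group_carrierE:
  assumes "a \<in> carrier (eps_group X p \<epsilon>)"
  obtains \<alpha> where "a = eps_class X \<epsilon> \<alpha>" "eps_chain X \<epsilon> \<alpha>" "hd \<alpha> = p" "last \<alpha> = p" "\<alpha> \<noteq> []"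
  using assms by (auto simp: eps_group_def eps_chain_def)

lemma eps_group_carrierI:
  "eps_chain X \<epsilon> \<alpha> \<Longrightarrow> hd \<alpha> = p \<Longrightarrow> last \<alpha> = p \<Longrightarrow> eps_class X \<epsilon> \<alpha> \<in> carrier (eps_group X p \<epsilon>)"
  by (auto simp: eps_group_def)

lemma eps_group_mult: "a \<otimes>\<^bsub>eps_group X p \<epsilon>\<^esub> b = class_concat X \<epsilon> a b"
  and eps_group_one: "\<one>\<^bsub>eps_group X p \<epsilon>\<^esub> = eps_class X \<epsilon> [p]"
  by (simp_all add: eps_group_def)

lemma group_eps_group:
  assumes "p \<in> mspace X" "0 < \<epsilon>"
  shows "group (eps_group X p \<epsilon>)"
proof (rule groupI)
  let ?G = "eps_group X p \<epsilon>"
  have one: "eps_chain X \<epsilon> [p]" using assms by (simp add: eps_chain_def)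
  show "\<one>\<^bsub>?G\<^esub> \<in> carrier ?G"
    unfolding eps_group_one using one by (intro eps_group_carrierI) auto
  fix x assume x: "x \<in> carrier ?G"
  then obtain \<alpha> where \<alpha>: "x = eps_class X \<epsilon> \<alpha>" "eps_chain X \<epsilon> \<alpha>" "hd \<alpha> = p" "last \<alpha> = p" "\<alpha> \<noteq> []"
    by (rule eps_group_carrierE)
  have "\<one>\<^bsub>?G\<^esub> \<otimes>\<^bsub>?G\<^esub> x = eps_class X \<epsilon> (chain_concat [p] \<alpha>)"
    unfolding eps_group_one eps_group_mult using \<alpha> one by (simp add: class_concat_class)
  also have "chain_concat [p] \<alpha> = \<alpha>" using \<alpha> by (metis chain_concat_single(2) list.collapse)
  finally show "\<one>\<^bsub>?G\<^esub> \<otimes>\<^bsub>?G\<^esub> x = x" using \<alpha> by simp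
  show "\<exists>y \<in> carrier ?G. y \<otimes>\<^bsub>?G\<^esub> x = \<one>\<^bsub>?G\<^esub>"
  proof
    have r: "eps_chain X \<epsilon> (rev \<alpha>)" "hd (rev \<alpha>) = p" "last (rev \<alpha>) = p"
      using \<alpha> eps_chain_rev by (auto simp: hd_rev last_rev)
    then show "eps_class X \<epsilon> (rev \<alpha>) \<in> carrier ?G" by (intro eps_group_carrierI)
    have "eps_homotopic X \<epsilon> (chain_concat (rev \<alpha>) \<alpha>) [p]"
      using eps_homotopic_rev_concat[OF \<alpha>(2) assms(2)] \<alpha> by simp
    then have "eps_class X \<epsilon> (chain_concat (rev \<alpha>) \<alpha>) = eps_class X \<epsilon> [p]"
      using eps_class_eq_iff eps_homotopicD(1) by metis
    then show "eps_class X \<epsilon> (rev \<alpha>) \<otimes>\<^bsub>?G\<^esub> x = \<one>\<^bsub>?G\<^esub>"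
      unfolding eps_group_one eps_group_mult using \<alpha> r by (simp add: class_concat_class)
  qed
  fix y assume "y \<in> carrier ?G"
  then obtain \<beta> where \<beta>: "y = eps_class X \<epsilon> \<beta>" "eps_chain X \<epsilon> \<beta>" "hd \<beta> = p" "last \<beta> = p" "\<beta> \<noteq> []"
    by (rule eps_group_carrierE)
  show "x \<otimes>\<^bsub>?G\<^esub> y \<in> carrier ?G"
    unfolding eps_group_mult using \<alpha> \<beta>
    by (auto simp: class_concat_class chain_concat_simps(1,2) intro!: eps_group_carrierI eps_chain_concat)
  fix z assume "z \<in> carrier ?G"
  then obtain \<gamma> where \<gamma>: "z = eps_class X \<epsilon> \<gamma>" "eps_chain X \<epsilon> \<gamma>" "hd \<gamma> = p" "last \<gamma> = p" "\<gamma> \<noteq> []"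
    by (rule eps_group_carrierE)
  show "x \<otimes>\<^bsub>?G\<^esub> y \<otimes>\<^bsub>?G\<^esub> z = x \<otimes>\<^bsub>?G\<^esub> (y \<otimes>\<^bsub>?G\<^esub> z)"
    unfolding eps_group_mult using \<alpha> \<beta> \<gamma>
    by (simp add: class_concat_class chain_concat_simps(1,2) eps_chain_concat chain_concat_assoc)
qed

end

theory Submission
  imports Defs
begin

text \<open>
  Choosing preimages up to \<open>\<sigma>\<close> gives a coarse inverse \<open>g\<close> of \<open>f\<close>. It maps \<open>\<omega>\<^sub>0\<close>-homotopies in \<open>X\<close> to
  \<open>\<delta>\<close>-homotopies, and chains that are pointwise close are homotopic. So two \<open>\<delta>\<close>-chains with the same
  ends and \<open>\<epsilon>\<close>-homotopic images are \<open>\<delta>\<close>-homotopic: after refinement the images are \<open>\<omega>\<^sub>0\<close>-chains, which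
  are \<open>\<omega>\<^sub>0\<close>-homotopic because \<open>\<phi>\<close> is injective. For the metric estimate one uses that in a geodesic
  space every chain of length \<open>L\<close> is homotopic to one that is no longer and has at most
  about \<open>L / s\<close> edges, where \<open>s\<close> may be taken of the order of \<open>\<epsilon>\<close>. Mapping such a chain by \<open>f\<close>, or
  lifting it by \<open>g\<close>, adds at most \<open>\<sigma> (4 L / \<epsilon> + 1)\<close> to its length. Applying this bound to the
  distance \<open>D'\<close> in \<open>X\<^sub>\<epsilon>\<close>, which is itself bounded by \<open>D + \<sigma> (4 D / \<epsilon> + 1)\<close>, yields \<open>p(\<sigma>, \<epsilon>)\<close>.
\<close>

section \<open>Homotopies of chains\<close>

lemma eps_homotopic_mono:
  assumes "eps_homotopic X \<delta> \<alpha> \<beta>" "\<delta> \<le> \<epsilon>"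
  shows "eps_homotopic X \<epsilon> \<alpha> \<beta>"
  using eps_homotopic_map[of "\<lambda>x. x" X X \<delta> \<epsilon> \<alpha> \<beta>] assms by auto

lemma eps_chain_mono: "eps_chain X \<delta> \<alpha> \<Longrightarrow> \<delta> \<le> \<epsilon> \<Longrightarrow> eps_chain X \<epsilon> \<alpha>"
  using eps_homotopic_mono eps_homotopic_refl eps_homotopicD(1) by metis

lemma eps_chain_Cons_Cons:
  "eps_chain X \<epsilon> (x # y # xs) \<longleftrightarrow> x \<in> mspace X \<and> mdist X x y < \<epsilon> \<and> eps_chain X \<epsilon> (y # xs)"
  by (auto simp: eps_chain_def)

lemma eps_homotopic_Cons:
  assumes "eps_homotopic X \<epsilon> \<alpha> \<beta>" "x \<in> mspace X" "mdist X x (hd \<alpha>) < \<epsilon>"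
  shows "eps_homotopic X \<epsilon> (x # \<alpha>) (x # \<beta>)"
proof -
  note c = eps_homotopicD[OF assms(1)]
  have ne: "\<alpha> \<noteq> []" "\<beta> \<noteq> []" using c(1,2) by (auto simp: eps_chain_def)
  have "hd \<alpha> \<in> mspace X" using c(1) ne hd_in_set by (auto simp: eps_chain_def)
  then have "eps_chain X \<epsilon> [x, hd \<alpha>]" using assms by (simp add: eps_chain_def)
  then have "eps_homotopic X \<epsilon> (chain_concat [x, hd \<alpha>] \<alpha>) (chain_concat [x, hd \<alpha>] \<beta>)"
    using assms(1) by (intro eps_homotopic_concat eps_homotopic_refl) simp_all
  then show ?thesis using ne c(3) by (cases \<alpha>; cases \<beta>) (auto simp: chain_concat_def)
qed

lemma eps_homotopic_snoc:
  assumes "eps_homotopic X \<epsilon> \<alpha> \<beta>" "x \<in> mspace X" "mdist X (last \<alpha>) x < \<epsilon>"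
  shows "eps_homotopic X \<epsilon> (\<alpha> @ [x]) (\<beta> @ [x])"
proof -
  have "\<alpha> \<noteq> []" using eps_homotopicD(1)[OF assms(1)] by (simp add: eps_chain_def)
  then have "eps_homotopic X \<epsilon> (x # rev \<alpha>) (x # rev \<beta>)"
    using assms by (intro eps_homotopic_Cons eps_homotopic_rev) (auto simp: hd_rev mdist_commute)
  from eps_homotopic_rev[OF this] show ?thesis by simp
qed

text \<open>A homotopy keeps its own ends fixed, so the two outer edges survive every step. This
  serves for chains moved by \<open>g \<circ> f\<close>, whose shifted ends are framed by the true
  ones.\<close>

lemma eps_homotopic_frame:
  assumes "eps_homotopic X \<epsilon> \<alpha> \<beta>" "eps_chain X \<epsilon> (x # \<alpha> @ [y])"
  shows "eps_homotopic X \<epsilon> (x # \<alpha> @ [y]) (x # \<beta> @ [y])"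
proof (rule eps_homotopic_Cons)
  have ne: "\<alpha> \<noteq> []" using eps_homotopicD(1)[OF assms(1)] by (simp add: eps_chain_def)
  then show "mdist X x (hd (\<alpha> @ [y])) < \<epsilon>"
    using assms(2) by (cases \<alpha>) (auto simp: eps_chain_def)
  have "mdist X (last \<alpha>) y < \<epsilon>"
    using assms(2) ne by (cases \<alpha> rule: rev_cases)
      (auto simp: eps_chain_def successively_Cons successively_append_iff split: if_splits)
  then show "eps_homotopic X \<epsilon> (\<alpha> @ [y]) (\<beta> @ [y])"
    using assms by (intro eps_homotopic_snoc) (auto simp: eps_chain_def)
  show "x \<in> mspace X" using assms(2) by (simp add: eps_chain_def)
qed

lemma eps_homotopic_remove:
  assumes "eps_chain X \<epsilon> (x # y # z # xs)" "mdist X x z < \<epsilon>"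
  shows "eps_homotopic X \<epsilon> (x # y # z # xs) (x # z # xs)"
proof (rule eps_homotopic_step)
  have "adds_point (x # z # xs) (x # y # z # xs)"
    unfolding adds_point_def by (auto intro!: exI[of _ "[x]"])
  then show "eps_step X \<epsilon> (x # y # z # xs) (x # z # xs)"
    using assms by (auto simp: eps_step_def eps_chain_def)
qed

section \<open>Repeated end points and cancellation of chains\<close>

lemma eps_homotopic_double_hd:
  assumes "eps_chain X \<epsilon> (x # xs)" "0 < \<epsilon>"
  shows "eps_homotopic X \<epsilon> (x # x # xs) (x # xs)"
proof (rule eps_homotopic_step)
  have "adds_point (x # xs) (x # x # xs)"
    unfolding adds_point_def by (auto intro!: exI[of _ "[x]"])
  then show "eps_step X \<epsilon> (x # x # xs) (x # xs)"
    using assms by (auto simp: eps_step_def eps_chain_def)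
qed

lemma eps_homotopic_double_last:
  assumes "eps_chain X \<epsilon> \<alpha>" "0 < \<epsilon>"
  shows "eps_homotopic X \<epsilon> (\<alpha> @ [last \<alpha>]) \<alpha>"
proof -
  obtain xs x where \<alpha>: "rev \<alpha> = x # xs" using assms(1) by (cases "rev \<alpha>") (auto simp: eps_chain_def)
  have "eps_homotopic X \<epsilon> (x # x # xs) (x # xs)"
    using eps_chain_rev[OF assms(1)] assms(2) \<alpha> by (intro eps_homotopic_double_hd) simp_all
  from eps_homotopic_rev[OF this] have "eps_homotopic X \<epsilon> (rev (x # rev \<alpha>)) (rev (rev \<alpha>))"
    by (simp only: \<alpha>)
  moreover have "last \<alpha> = x" using \<alpha> by (metis hd_rev list.sel(1))
  ultimately show ?thesis by simp
qed

text \<open>Prepending \<open>rev \<alpha>\<close> to both sides creates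
  \<open>chain_concat (rev \<alpha>) \<alpha>\<close>, which contracts to a point. A relation
  between based chains thus becomes one in the class whose lengths define
  \<open>eps_dist\<close>.\<close>

lemma eps_homotopic_cancel:
  assumes "eps_chain X \<epsilon> \<alpha>" "0 < \<epsilon>" "eps_chain X \<epsilon> \<gamma>" "last \<alpha> = hd \<gamma>"
    and "eps_homotopic X \<epsilon> (chain_concat \<alpha> \<gamma>) \<beta>"
  shows "eps_homotopic X \<epsilon> \<gamma> (chain_concat (rev \<alpha>) \<beta>)"
proof -
  have ne: "\<alpha> \<noteq> []" "\<gamma> \<noteq> []" using assms by (auto simp: eps_chain_def)
  have "eps_homotopic X \<epsilon> (chain_concat (chain_concat (rev \<alpha>) \<alpha>) \<gamma>) (chain_concat [last \<alpha>] \<gamma>)"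
    using assms ne eps_homotopic_rev_concat[OF assms(1,2)]
    by (intro eps_homotopic_concat eps_homotopic_refl) (auto simp: chain_concat_simps(1,2) last_rev)
  moreover have "chain_concat [last \<alpha>] \<gamma> = \<gamma>"
    using assms(4) ne by (cases \<gamma>) auto
  moreover have "chain_concat (chain_concat (rev \<alpha>) \<alpha>) \<gamma> = chain_concat (rev \<alpha>) (chain_concat \<alpha> \<gamma>)"
    using ne by (simp add: chain_concat_assoc)
  ultimately have 1: "eps_homotopic X \<epsilon> \<gamma> (chain_concat (rev \<alpha>) (chain_concat \<alpha> \<gamma>))"
    using eps_homotopic_sym by metis
  have "eps_homotopic X \<epsilon> (chain_concat (rev \<alpha>) (chain_concat \<alpha> \<gamma>)) (chain_concat (rev \<alpha>) \<beta>)"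
    using assms ne by (intro eps_homotopic_concat eps_homotopic_refl eps_chain_rev)
      (auto simp: chain_concat_simps(1,2) last_rev)
  with 1 show ?thesis by (rule eps_homotopic_trans)
qed

lemma eps_homotopic_cancel':
  assumes "eps_chain X \<epsilon> \<alpha>" "0 < \<epsilon>" "eps_chain X \<epsilon> \<beta>" "hd \<alpha> = hd \<beta>"
    and "eps_homotopic X \<epsilon> (chain_concat (rev \<alpha>) \<beta>) \<gamma>"
  shows "eps_homotopic X \<epsilon> (chain_concat \<alpha> \<gamma>) \<beta>"
proof -
  have "\<alpha> \<noteq> []" using assms by (auto simp: eps_chain_def)
  then have "eps_homotopic X \<epsilon> \<beta> (chain_concat (rev (rev \<alpha>)) \<gamma>)"
    using assms by (intro eps_homotopic_cancel eps_chain_rev) (auto simp: last_rev)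
  then show ?thesis using eps_homotopic_sym by simp
qed

text \<open>The zigzag \<open>x\<^sub>0, x\<^sub>1, y\<^sub>1\<close> becomes \<open>x\<^sub>0, y\<^sub>0, y\<^sub>1\<close> through \<open>x\<^sub>0, y\<^sub>1\<close>,
  which is where the margin \<open>\<tau>\<close> is used.\<close>

lemma eps_homotopic_close:
  assumes "eps_chain X (\<epsilon> - \<tau>) \<alpha>" "eps_chain X \<epsilon> \<beta>" "list_all2 (\<lambda>x y. mdist X x y \<le> \<tau>) \<alpha> \<beta>" "\<tau> < \<epsilon>"
  shows "eps_homotopic X \<epsilon> (\<alpha> @ [last \<beta>]) (hd \<alpha> # \<beta>)"
  using assms(1-3)
proof (induction \<alpha> arbitrary: \<beta> rule: induct_list012)
  case 1
  then show ?case by (simp add: eps_chain_def)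
next
  case (2 x)
  then obtain y where "\<beta> = [y]" "mdist X x y \<le> \<tau>" by (auto simp: list_all2_Cons1)
  then show ?case using 2 assms(4) by (auto intro!: eps_homotopic_refl simp: eps_chain_def)
next
  case (3 x\<^sub>0 x\<^sub>1 xs)
  then obtain y\<^sub>0 y\<^sub>1 ys where \<beta>: "\<beta> = y\<^sub>0 # y\<^sub>1 # ys" "mdist X x\<^sub>0 y\<^sub>0 \<le> \<tau>" "mdist X x\<^sub>1 y\<^sub>1 \<le> \<tau>"
    "list_all2 (\<lambda>x y. mdist X x y \<le> \<tau>) (x\<^sub>1 # xs) (y\<^sub>1 # ys)"
    by (auto simp: list_all2_Cons1)
  have \<tau>: "0 \<le> \<tau>" using order_trans[OF mdist_nonneg \<beta>(2)] .
  have c: "eps_chain X (\<epsilon> - \<tau>) (x\<^sub>1 # xs)" "eps_chain X \<epsilon> (y\<^sub>1 # ys)"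
    and x: "x\<^sub>0 \<in> mspace X" "x\<^sub>1 \<in> mspace X" "mdist X x\<^sub>0 x\<^sub>1 < \<epsilon> - \<tau>"
    and y: "y\<^sub>0 \<in> mspace X" "y\<^sub>1 \<in> mspace X" "mdist X y\<^sub>0 y\<^sub>1 < \<epsilon>"
    using 3(3,4) \<beta>(1) by (auto simp: eps_chain_def)
  have "mdist X x\<^sub>0 y\<^sub>1 < \<epsilon>" using mdist_triangle[of x\<^sub>0 X x\<^sub>1 y\<^sub>1] x y \<beta> by simp
  then have 1: "eps_homotopic X \<epsilon> (x\<^sub>0 # x\<^sub>1 # y\<^sub>1 # ys) (x\<^sub>0 # y\<^sub>1 # ys)"
    "eps_homotopic X \<epsilon> (x\<^sub>0 # y\<^sub>0 # y\<^sub>1 # ys) (x\<^sub>0 # y\<^sub>1 # ys)"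
    using x y c(2) \<beta> assms(4) \<tau> by (auto intro!: eps_homotopic_remove simp: eps_chain_Cons_Cons)
  have "eps_homotopic X \<epsilon> ((x\<^sub>1 # xs) @ [last (y\<^sub>1 # ys)]) (x\<^sub>1 # y\<^sub>1 # ys)"
    using 3(2)[OF c \<beta>(4)] by simp
  then have "eps_homotopic X \<epsilon> (x\<^sub>0 # (x\<^sub>1 # xs) @ [last (y\<^sub>1 # ys)]) (x\<^sub>0 # x\<^sub>1 # y\<^sub>1 # ys)"
    using x \<tau> by (intro eps_homotopic_Cons) auto
  with eps_homotopic_trans[OF 1(1) eps_homotopic_sym[OF 1(2)]]
  have "eps_homotopic X \<epsilon> (x\<^sub>0 # (x\<^sub>1 # xs) @ [last (y\<^sub>1 # ys)]) (x\<^sub>0 # y\<^sub>0 # y\<^sub>1 # ys)"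
    using eps_homotopic_trans by blast
  then show ?case by (simp add: \<beta>(1))
qed

section \<open>Subdivision in geodesic spaces\<close>

text \<open>Along a path as long as the distance of its ends, the intermediate value theorem gives a
  point at distance \<open>c\<close> from \<open>x\<close>. The partition \<open>[0, t, 1]\<close>
  is no longer than the path, so the triangle inequality is an equality there.\<close>

lemma geodesic_space_between:
  assumes "geodesic_space X" "x \<in> mspace X" "y \<in> mspace X" "0 \<le> c" "c \<le> mdist X x y"
  obtains m where "m \<in> mspace X" "mdist X x m = c" "mdist X m y = mdist X x y - c"
proof -
  obtain g where g: "pathin (mtopology_of X) g" "g 0 = x" "g 1 = y"
    and len: "path_length X g = ennreal (mdist X x y)"
    using assms(1-3) unfolding geodesic_space_def by blast
  have gm: "g t \<in> mspace X" if "t \<in> {0..1}" for t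
    using g(1) that by (auto simp: pathin_def continuous_map_def)
  have "continuous_map (top_of_set {0..1}) euclidean (\<lambda>t. mdist X x (g t))"
    using g(1) assms(2) unfolding pathin_def
    by (intro continuous_map_mdist) auto
  then have cont: "continuous_on {0..1} (\<lambda>t. mdist X x (g t))" by simp
  have "\<exists>t\<ge>0. t \<le> 1 \<and> mdist X x (g t) = c"
    using IVT'[of "\<lambda>t. mdist X x (g t)" 0 c 1] cont assms g(2,3) by auto
  then obtain t where t: "0 \<le> t" "t \<le> 1" "mdist X x (g t) = c" by blast
  have "ennreal (chain_length X (map g [0, t, 1])) \<le> path_length X g"
    unfolding path_length_def using t by (intro SUP_upper) auto
  then have "chain_length X (map g [0, t, 1]) \<le> mdist X x y"
    unfolding len by (simp only: ennreal_le_iff mdist_nonneg)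
  then have "mdist X x (g t) + mdist X (g t) y \<le> mdist X x y"
    by (simp add: g(2,3))
  moreover have "mdist X x y \<le> mdist X x (g t) + mdist X (g t) y"
    using gm[of t] t assms by (intro mdist_triangle) auto
  ultimately show ?thesis using that[of "g t"] gm[of t] t by simp
qed

text \<open>Pieces of length \<open>\<mu> / 2\<close> are split off at the front until the rest is
  shorter than \<mu>; \<open>n\<close> bounds the number of cuts and drives the induction.\<close>

lemma geodesic_space_subdivide:
  assumes "geodesic_space X" "x \<in> mspace X" "y \<in> mspace X" "0 < \<mu>"
  obtains zs where "eps_chain X \<mu> (x # zs @ [y])" "chain_length X (x # zs @ [y]) = mdist X x y"
proof -
  have "\<exists>zs. eps_chain X \<mu> (x # zs @ [y]) \<and> chain_length X (x # zs @ [y]) = mdist X x y"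
    if "x \<in> mspace X" "mdist X x y \<le> real n * (\<mu> / 2)" for n x
    using that
  proof (induction n arbitrary: x)
    case 0
    then show ?case using assms by (intro exI[of _ "[]"]) (auto simp: eps_chain_def)
  next
    case (Suc n)
    show ?case
    proof (cases "mdist X x y < \<mu>")
      case True
      then show ?thesis using assms Suc by (intro exI[of _ "[]"]) (auto simp: eps_chain_def)
    next
      case False
      then obtain m where m: "m \<in> mspace X" "mdist X x m = \<mu> / 2" "mdist X m y = mdist X x y - \<mu> / 2"
        using geodesic_space_between[OF assms(1) Suc(2) assms(3), of "\<mu> / 2"] assms(4) by auto
      have "mdist X m y \<le> real n * (\<mu> / 2)" using m Suc(3) by (simp add: algebra_simps)
      then obtain zs where "eps_chain X \<mu> (m # zs @ [y])" "chain_length X (m # zs @ [y]) = mdist X m y"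
        using Suc.IH m by blast
      then show ?thesis using m Suc(2) assms(4)
        by (intro exI[of _ "m # zs"]) (auto simp: eps_chain_Cons_Cons)
    qed
  qed
  moreover obtain n where "mdist X x y / (\<mu> / 2) < real n" using reals_Archimedean2 by blast
  then have "mdist X x y \<le> real n * (\<mu> / 2)" using assms(4) by (simp add: field_simps)
  ultimately show ?thesis using that assms by blast
qed

text \<open>Each edge is subdivided separately. Its pieces have total length below \<epsilon>, so
  \<open>short_chain\<close> contracts them back to the edge.\<close>

lemma geodesic_space_refine:
  assumes "geodesic_space X" "eps_chain X \<epsilon> \<alpha>" "0 < \<mu>" "\<mu> \<le> \<epsilon>"
  obtains \<beta> where "eps_chain X \<mu> \<beta>" "eps_homotopic X \<epsilon> \<alpha> \<beta>" "chain_length X \<beta> = chain_length X \<alpha>"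
proof -
  have "\<exists>\<beta>. eps_chain X \<mu> \<beta> \<and> eps_homotopic X \<epsilon> \<alpha> \<beta> \<and> chain_length X \<beta> = chain_length X \<alpha>"
    using assms(2)
  proof (induction \<alpha> rule: induct_list012)
    case (3 x y xs)
    have c: "x \<in> mspace X" "y \<in> mspace X" "mdist X x y < \<epsilon>" "eps_chain X \<epsilon> (y # xs)"
      using 3(3) by (auto simp: eps_chain_def)
    obtain zs where zs: "eps_chain X \<mu> (x # zs @ [y])" "chain_length X (x # zs @ [y]) = mdist X x y"
      using geodesic_space_subdivide[OF assms(1) c(1,2) assms(3)] by blast
    obtain \<beta> where \<beta>: "eps_chain X \<mu> \<beta>" "eps_homotopic X \<epsilon> (y # xs) \<beta>"
      "chain_length X \<beta> = chain_length X (y # xs)"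
      using 3(2)[OF c(4)] by blast
    have hd: "hd \<beta> = y" "\<beta> \<noteq> []" using eps_homotopicD[OF \<beta>(2)] by (auto simp: eps_chain_def)
    have "eps_homotopic X \<epsilon> (x # zs @ [y]) [x, y]"
      using short_chain[of X \<epsilon> x "zs @ [y]"] zs c eps_chain_mono[OF zs(1) assms(4)] by simp
    then have "eps_homotopic X \<epsilon> (chain_concat [x, y] (y # xs)) (chain_concat (x # zs @ [y]) \<beta>)"
      using \<beta> by (intro eps_homotopic_concat eps_homotopic_sym[of _ _ "x # zs @ [y]"]) auto
    moreover have "eps_chain X \<mu> (chain_concat (x # zs @ [y]) \<beta>)"
      using zs \<beta> hd by (intro eps_chain_concat) auto
    moreover have "chain_length X (chain_concat (x # zs @ [y]) \<beta>) = chain_length X (x # y # xs)"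
      using zs \<beta> hd by (subst chain_length_concat) auto
    ultimately show ?case by (auto simp: chain_concat_def)
  next
    case (2 x)
    then show ?case by (intro exI[of _ "[x]"]) (auto simp: eps_chain_def eps_homotopic_def)
  qed (simp add: eps_chain_def)
  then show ?thesis using that by blast
qed

text \<open>In the induction \<open>r\<close> is the length of the part of the fine chain that the first edge of the
  coarse chain replaces. A new edge is opened only when \<open>r\<close> exceeds \<open>s - \<mu>\<close>.\<close>

lemma geodesic_space_coarsen:
  assumes "geodesic_space X" "eps_chain X \<epsilon> \<alpha>" "0 < \<mu>" "\<mu> \<le> s" "s \<le> \<epsilon>"
  obtains x zs y where "eps_chain X s (x # zs @ [y])" "eps_homotopic X \<epsilon> \<alpha> (x # zs @ [y])"
    "chain_length X (x # zs @ [y]) \<le> chain_length X \<alpha>"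
    "real (length zs) * (s - \<mu>) \<le> chain_length X \<alpha>"
proof -
  have "\<exists>z zs r. eps_chain X s (x # z # zs) \<and> eps_homotopic X s (x # xs) (x # z # zs) \<and>
      chain_length X (x # z # zs) \<le> chain_length X (x # xs) \<and> mdist X x z \<le> r \<and> r < s \<and>
      r + real (length zs) * (s - \<mu>) \<le> chain_length X (x # xs)"
    if "eps_chain X \<mu> (x # xs)" for x xs
    using that
  proof (induction xs arbitrary: x)
    case Nil
    then have "x \<in> mspace X" by (simp add: eps_chain_def)
    \<comment> \<open>A single point is doubled because the coarse chain must have a first edge;
      here \<open>r = 0\<close>.\<close>
    then show ?case using assms eps_homotopic_sym[OF eps_homotopic_double[of x X s]]
      by (intro exI[of _ x] exI[of _ "[]"] exI[of _ 0]) (auto simp: eps_chain_def)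
  next
    case (Cons y ys)
    have c: "x \<in> mspace X" "mdist X x y < \<mu>" "eps_chain X \<mu> (y # ys)" "y \<in> mspace X"
      using Cons.prems by (auto simp: eps_chain_def)
    obtain z zs r where *: "eps_chain X s (y # z # zs)" "eps_homotopic X s (y # ys) (y # z # zs)"
      "chain_length X (y # z # zs) \<le> chain_length X (y # ys)" "mdist X y z \<le> r" "r < s"
      "r + real (length zs) * (s - \<mu>) \<le> chain_length X (y # ys)"
      using Cons.IH[OF c(3)] by blast
    have h: "eps_homotopic X s (x # y # ys) (x # y # z # zs)"
      using eps_homotopic_Cons[OF *(2) c(1)] c(2) assms(4) by simp
    have z: "z \<in> mspace X" using *(1) by (simp add: eps_chain_def)
    have tri: "mdist X x z \<le> mdist X x y + mdist X y z" using c z by (intro mdist_triangle)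
    show ?case
    proof (cases "r + mdist X x y < s")
      case True
      then have "mdist X x z < s" using tri * by simp
      then have "eps_homotopic X s (x # y # z # zs) (x # z # zs)"
        using eps_homotopicD(2)[OF h] by (intro eps_homotopic_remove)
      then have "eps_homotopic X s (x # y # ys) (x # z # zs)" using h eps_homotopic_trans by blast
      then show ?thesis using True tri * eps_homotopicD(2)[of X s "x # y # ys" "x # z # zs"]
        by (intro exI[of _ z] exI[of _ zs] exI[of _ "r + mdist X x y"]) auto
    next
      case False
      then have "s - \<mu> \<le> r" using c by simp
      then have "mdist X x y + real (length (z # zs)) * (s - \<mu>) \<le> chain_length X (x # y # ys)"
        using * by (simp add: algebra_simps)
      then show ?thesis using h * c assms(4) eps_homotopicD(2)[OF h]
        by (intro exI[of _ y] exI[of _ "z # zs"] exI[of _ "mdist X x y"]) auto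
    qed
  qed note main = this
  obtain \<beta> where \<beta>: "eps_chain X \<mu> \<beta>" "eps_homotopic X \<epsilon> \<alpha> \<beta>" "chain_length X \<beta> = chain_length X \<alpha>"
    using geodesic_space_refine[OF assms(1-3)] assms by auto
  obtain x xs where x: "\<beta> = x # xs" using \<beta>(1) by (cases \<beta>) (auto simp: eps_chain_def)
  then obtain z zs r where *: "eps_chain X s (x # z # zs)" "eps_homotopic X s \<beta> (x # z # zs)"
    "chain_length X (x # z # zs) \<le> chain_length X \<alpha>" "mdist X x z \<le> r"
    "r + real (length zs) * (s - \<mu>) \<le> chain_length X \<alpha>"
    using main[of x xs] \<beta> by auto
  \<comment> \<open>The contribution \<open>r\<close> of the first edge is dropped from the
    estimate. The remaining \<open>length zs\<close> edges are as many as the interior points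
    \<open>ws\<close>.\<close>
  have "0 \<le> r" using order_trans[OF mdist_nonneg *(4)] .
  moreover obtain ws y where ws: "z # zs = ws @ [y]" by (metis list.discI rev_exhaust)
  moreover have "length ws = length zs" using arg_cong[OF ws, of length] by simp
  moreover have "eps_homotopic X \<epsilon> \<alpha> (x # z # zs)"
    using \<beta>(2) eps_homotopic_mono[OF *(2) assms(5)] eps_homotopic_trans by blast
  ultimately show ?thesis using * that[of x ws y] by simp
qed



section \<open>Distances between classes\<close>

lemma eps_dist_le:
  assumes "eps_chain X \<epsilon> \<alpha>" "hd \<alpha> = p" "eps_chain X \<epsilon> \<beta>" "hd \<beta> = p"
    and "eps_homotopic X \<epsilon> \<gamma> (chain_concat (rev \<alpha>) \<beta>)"
  shows "eps_dist X p \<epsilon> (eps_class X \<epsilon> \<alpha>) (eps_class X \<epsilon> \<beta>) \<le> chain_length X \<gamma>"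
proof -
  have "\<gamma> \<in> eps_class X \<epsilon> (chain_concat (rev \<alpha>) \<beta>)"
    using assms(5) eps_homotopic_sym by (auto simp: eps_class_def)
  moreover have "bdd_below (chain_length X ` eps_class X \<epsilon> (chain_concat (rev \<alpha>) \<beta>))"
    using chain_length_nonneg by (intro bdd_belowI[of _ 0]) auto
  ultimately show ?thesis
    unfolding eps_dist_class[OF assms(1-4)] by (intro cINF_lower)
qed

text \<open>The class contains its representative, so the real infimum runs over a nonempty set and
  inherits every lower bound.\<close>

lemma eps_dist_ge:
  assumes "eps_chain X \<epsilon> \<alpha>" "hd \<alpha> = p" "eps_chain X \<epsilon> \<beta>" "hd \<beta> = p"
    and "\<And>\<gamma>. eps_homotopic X \<epsilon> (chain_concat (rev \<alpha>) \<beta>) \<gamma> \<Longrightarrow> c \<le> chain_length X \<gamma>"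
  shows "c \<le> eps_dist X p \<epsilon> (eps_class X \<epsilon> \<alpha>) (eps_class X \<epsilon> \<beta>)"
proof -
  have "eps_chain X \<epsilon> (chain_concat (rev \<alpha>) \<beta>)"
    using assms by (intro eps_chain_concat eps_chain_rev) (auto simp: last_rev eps_chain_def)
  then have "eps_class X \<epsilon> (chain_concat (rev \<alpha>) \<beta>) \<noteq> {}"
    using eps_homotopic_refl by (auto simp: eps_class_def)
  then show ?thesis
    unfolding eps_dist_class[OF assms(1-4)] using assms(5)
    by (intro cINF_greatest) (auto simp: eps_class_def)
qed

lemma map_chain_concat: "map f (chain_concat \<alpha> \<beta>) = chain_concat (map f \<alpha>) (map f \<beta>)"
  by (simp add: chain_concat_def map_tl)

section \<open>Lifting chains along an approximate isometry\<close>

text \<open>The map \<open>g\<close> is any choice of approximate preimages. It need not be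
  continuous, and it need not send \<open>f y\<close> back to \<open>y\<close>, not even at the base
  point.\<close>

locale coarse_inverse =
  fixes Y :: "'b metric" and X :: "'a metric" and f :: "'b \<Rightarrow> 'a" and g :: "'a \<Rightarrow> 'b" and \<sigma> :: real
  assumes f: "f \<in> mspace Y \<rightarrow> mspace X"
    and g: "g \<in> mspace X \<rightarrow> mspace Y"
    and dist: "\<And>x y. x \<in> mspace Y \<Longrightarrow> y \<in> mspace Y \<Longrightarrow> \<bar>mdist Y x y - mdist X (f x) (f y)\<bar> \<le> \<sigma>"
    and close: "\<And>z. z \<in> mspace X \<Longrightarrow> mdist X z (f (g z)) \<le> \<sigma>"
    and nonneg: "0 \<le> \<sigma>"
begin

text \<open>A relation rather than \<open>map g\<close>, so that the ends of a lift can be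
  prescribed while \<open>g\<close> is used only for the interior points.\<close>

definition lifts :: "'a list \<Rightarrow> 'b list \<Rightarrow> bool" where
  "lifts \<eta> W \<longleftrightarrow> list_all2 (\<lambda>x w. w \<in> mspace Y \<and> mdist X x (f w) \<le> \<sigma>) \<eta> W"

lemma lifts_map:
  assumes "set \<eta> \<subseteq> mspace X" shows "lifts \<eta> (map g \<eta>)"
  using assms g close by (auto simp: lifts_def list.rel_map intro!: list.rel_refl_strong)

lemma f_le: "x \<in> mspace Y \<Longrightarrow> y \<in> mspace Y \<Longrightarrow> mdist X (f x) (f y) \<le> mdist Y x y + \<sigma>"
  using dist[of x y] by simp

text \<open>The errors at the two ends are kept as distances instead of being bounded by \<sigma>,
  because they vanish at ends that are lifted exactly.\<close>

lemma image_edge_le: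
  assumes "x \<in> mspace X" "y \<in> mspace X" "u \<in> mspace Y" "v \<in> mspace Y"
  shows "mdist X (f u) (f v) \<le> mdist X x y + mdist X x (f u) + mdist X y (f v)"
proof -
  have "f u \<in> mspace X" "f v \<in> mspace X" using assms f by auto
  then have "mdist X (f u) (f v) \<le> mdist X (f u) x + mdist X x (f v)"
    "mdist X x (f v) \<le> mdist X x y + mdist X y (f v)"
    using assms by (auto intro: mdist_triangle)
  then show ?thesis by (simp add: mdist_commute)
qed

lemma lift_edge_le:
  assumes "x \<in> mspace X" "y \<in> mspace X" "u \<in> mspace Y" "v \<in> mspace Y"
  shows "mdist Y u v \<le> mdist X x y + mdist X x (f u) + mdist X y (f v) + \<sigma>"
  using image_edge_le[OF assms] dist[OF assms(3,4)] by simp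

lemma f_homotopic:
  assumes "eps_homotopic Y \<delta> \<alpha> \<beta>" "\<delta> + \<sigma> \<le> \<epsilon>"
  shows "eps_homotopic X \<epsilon> (map f \<alpha>) (map f \<beta>)"
proof (rule eps_homotopic_map[OF f _ assms(1)], intro ballI impI)
  fix x y assume "x \<in> mspace Y" "y \<in> mspace Y" "mdist Y x y < \<delta>"
  then show "mdist X (f x) (f y) < \<epsilon>" using f_le[of x y] assms(2) by simp
qed

lemma f_chain: "eps_chain Y \<delta> \<alpha> \<Longrightarrow> \<delta> + \<sigma> \<le> \<epsilon> \<Longrightarrow> eps_chain X \<epsilon> (map f \<alpha>)"
  using f_homotopic[OF eps_homotopic_refl] eps_homotopicD(1) by blast

text \<open>An edge grows by at most \<sigma> at each end, from \<open>close\<close>, and by a third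
  \<sigma> from the distortion of \<open>f\<close>.\<close>

lemma g_homotopic:
  assumes "eps_homotopic X \<delta> \<alpha> \<beta>" "\<delta> + 3 * \<sigma> \<le> \<epsilon>"
  shows "eps_homotopic Y \<epsilon> (map g \<alpha>) (map g \<beta>)"
proof (rule eps_homotopic_map[OF g _ assms(1)], intro ballI impI)
  fix x y assume "x \<in> mspace X" "y \<in> mspace X" "mdist X x y < \<delta>"
  moreover from this have "g x \<in> mspace Y" "g y \<in> mspace Y" using g by auto
  ultimately show "mdist Y (g x) (g y) < \<epsilon>"
    using lift_edge_le[of x y "g x" "g y"] close[of x] close[of y] assms(2) by simp
qed

text \<open>The image of the lift is compared with \<eta> inside \<open>X\<close>, so only the two
  end errors enter there; passing to \<open>Y\<close> costs the distortion of \<open>f\<close> as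
  well.\<close>

lemma lifts_chain:
  assumes "eps_chain X s \<eta>" "lifts \<eta> W"
  shows "eps_chain Y (s + 3 * \<sigma>) W" "eps_chain X (s + 2 * \<sigma>) (map f W)"
proof -
  have "eps_chain Y (s + 3 * \<sigma>) W \<and> eps_chain X (s + 2 * \<sigma>) (map f W)"
    using assms
  proof (induction \<eta> arbitrary: W rule: induct_list012)
    case (2 x)
    then show ?case using f by (auto simp: lifts_def list_all2_Cons1 eps_chain_def)
  next
    case (3 x y xs)
    then obtain u v ws where W: "W = u # v # ws" "u \<in> mspace Y" "v \<in> mspace Y"
      "mdist X x (f u) \<le> \<sigma>" "mdist X y (f v) \<le> \<sigma>" "lifts (y # xs) (v # ws)"
      by (auto simp: lifts_def list_all2_Cons1)
    have c: "x \<in> mspace X" "y \<in> mspace X" "mdist X x y < s" "eps_chain X s (y # xs)"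
      using 3(3) by (auto simp: eps_chain_def)
    have "f u \<in> mspace X" using W f by auto
    moreover note 3(2)[OF c(4) W(6)] image_edge_le[OF c(1,2) W(2,3)] lift_edge_le[OF c(1,2) W(2,3)]
    ultimately show ?case using W c by (auto simp: eps_chain_Cons_Cons)
  qed (simp add: eps_chain_def)
  then show "eps_chain Y (s + 3 * \<sigma>) W" "eps_chain X (s + 2 * \<sigma>) (map f W)" by auto
qed

text \<open>The chains \<eta> and \<open>map f W\<close> are pointwise \<sigma>-close. Since the
  first points agree, the doubled one can be removed; the last points may differ, hence the extra
  edge to \<open>f (last W)\<close>.\<close>

lemma lifts_homotopic:
  assumes "eps_chain X s \<eta>" "lifts \<eta> W" "s + 2 * \<sigma> \<le> \<epsilon>" "0 < s"
    and "f (hd W) = hd \<eta>"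
  shows "eps_homotopic X \<epsilon> (\<eta> @ [f (last W)]) (map f W)"
proof -
  have ne: "\<eta> \<noteq> []" "W \<noteq> []" using assms(1,2) by (auto simp: eps_chain_def lifts_def)
  have c: "eps_chain X \<epsilon> (map f W)" using lifts_chain(2)[OF assms(1,2)] eps_chain_mono assms(3) by blast
  have "eps_homotopic X \<epsilon> (\<eta> @ [last (map f W)]) (hd \<eta> # map f W)"
  proof (rule eps_homotopic_close[of X \<epsilon> \<sigma>])
    show "eps_chain X (\<epsilon> - \<sigma>) \<eta>" using eps_chain_mono[OF assms(1)] assms(3) nonneg by simp
    show "list_all2 (\<lambda>x y. mdist X x y \<le> \<sigma>) \<eta> (map f W)"
      using assms(2) by (auto simp: lifts_def list_all2_map2 elim: list_all2_mono)
  qed (use c assms(3,4) nonneg in auto)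
  moreover have "eps_homotopic X \<epsilon> (hd \<eta> # map f W) (map f W)"
    using eps_homotopic_double_hd[of X \<epsilon> "hd \<eta>" "tl (map f W)"] c ne assms(3-5) nonneg
    by (cases W) auto
  ultimately show ?thesis using eps_homotopic_trans ne by (fastforce simp: last_map)
qed

text \<open>Every edge pays \<sigma> for the distortion, and every interior point pays \<sigma> in
  each of its two edges. The term for the first point stays explicit: in the induction it belongs to
  an interior point of the whole chain, at the outer end it may be zero.\<close>

lemma lifts_length:
  assumes "set (x # zs @ [y]) \<subseteq> mspace X" "lifts (x # zs @ [y]) (u # ws @ [v])" "f v = y"
  shows "chain_length Y (u # ws @ [v]) \<le>
    chain_length X (x # zs @ [y]) + 3 * \<sigma> * real (length zs) + \<sigma> + mdist X x (f u)"
  using assms(1,2)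
proof (induction zs arbitrary: x u ws)
  case Nil
  then have "ws = []" by (auto simp: lifts_def dest: list_all2_lengthD)
  then show ?case using Nil lift_edge_le[of x y u v] assms(3)
    by (auto simp: lifts_def)
next
  case (Cons z zs)
  then obtain w ws' where w: "ws = w # ws'" "w \<in> mspace Y" "u \<in> mspace Y" "mdist X z (f w) \<le> \<sigma>"
    "lifts (z # zs @ [y]) (w # ws' @ [v])"
    by (cases ws) (auto simp: lifts_def)
  have "chain_length Y (w # ws' @ [v]) \<le>
    chain_length X (z # zs @ [y]) + 3 * \<sigma> * real (length zs) + \<sigma> + mdist X z (f w)"
    using Cons.IH[OF _ w(5)] Cons.prems by simp
  moreover have "mdist Y u w \<le> mdist X x z + mdist X x (f u) + mdist X z (f w) + \<sigma>"
    using lift_edge_le[of x z u w] Cons.prems w by simp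
  ultimately show ?case using w(1,4) by (simp add: algebra_simps)
qed

lemma image_length: 
  assumes "set \<alpha> \<subseteq> mspace Y" "\<alpha> \<noteq> []"
  shows "chain_length X (map f \<alpha>) \<le> chain_length Y \<alpha> + \<sigma> * (real (length \<alpha>) - 1)"
  using assms
proof (induction \<alpha> rule: induct_list012)
  case (3 x y xs)
  then show ?case using f_le[of x y] by (simp add: algebra_simps)
qed auto

text \<open>Points move by at most \<open>2 * \<sigma>\<close> under \<open>g \<circ> f\<close>,
  which is the closeness used. Edges grow by \<sigma> under \<open>f\<close> and by
  \<open>3 * \<sigma>\<close> under \<open>g\<close>, hence the \<open>4 * \<sigma>\<close>.\<close>

lemma homotopic_g_f:
  assumes "eps_chain Y \<mu> \<gamma>" "\<mu> + 4 * \<sigma> \<le> \<delta>" "0 < \<mu>"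
  shows "eps_homotopic Y \<delta> \<gamma> (hd \<gamma> # map g (map f \<gamma>) @ [last \<gamma>])"
proof -
  have ne: "\<gamma> \<noteq> []" "set \<gamma> \<subseteq> mspace Y" using assms(1) by (auto simp: eps_chain_def)
  have fg: "g (f y) \<in> mspace Y" "mdist Y y (g (f y)) \<le> 2 * \<sigma>" if "y \<in> mspace Y" for y
  proof -
    have "f y \<in> mspace X" using f that by auto
    then show *: "g (f y) \<in> mspace Y" using g by auto
    show "mdist Y y (g (f y)) \<le> 2 * \<sigma>"
      using dist[OF that *] close[OF \<open>f y \<in> mspace X\<close>] by simp
  qed
  let ?x = "last \<gamma>" and ?\<kappa> = "map g (map f \<gamma>)"
  have x: "?x \<in> mspace Y" using ne last_in_set by blast
  have k: "last ?\<kappa> = g (f ?x)" using ne by (simp add: last_map)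
  have c: "eps_chain Y \<delta> ?\<kappa>"
    using eps_homotopicD(1)[OF g_homotopic[OF f_homotopic[OF eps_homotopic_refl[OF assms(1)] order_refl]]]
      assms(2) by simp
  have "eps_homotopic Y \<delta> (\<gamma> @ [last ?\<kappa>]) (hd \<gamma> # ?\<kappa>)"
  proof (rule eps_homotopic_close[of Y \<delta> "2 * \<sigma>"])
    show "eps_chain Y (\<delta> - 2 * \<sigma>) \<gamma>" using eps_chain_mono[OF assms(1)] assms(2) nonneg by simp
    show "list_all2 (\<lambda>x y. mdist Y x y \<le> 2 * \<sigma>) \<gamma> ?\<kappa>"
      using fg(2) ne(2) by (auto simp: list.rel_map intro!: list.rel_refl_strong)
  qed (use c assms(2,3) nonneg in auto)
  then have 1: "eps_homotopic Y \<delta> ((\<gamma> @ [g (f ?x)]) @ [?x]) ((hd \<gamma> # ?\<kappa>) @ [?x])"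
    unfolding k using x fg[OF x] assms(2,3) nonneg
    by (intro eps_homotopic_snoc) (auto simp: mdist_commute)
  \<comment> \<open>The excursion from the last point of \<gamma> to its shifted copy and back
    contracts, so it may be appended to \<gamma>.\<close>
  have "eps_chain Y \<delta> [?x, g (f ?x), ?x]" "0 < \<delta>"
    using x fg[OF x] assms(2,3) nonneg by (auto simp: eps_chain_def mdist_commute)
  then have "eps_homotopic Y \<delta> [?x, g (f ?x), ?x] [?x]"
    using eps_homotopic_rev_concat[of Y \<delta> "[g (f ?x), ?x]"]
    by (auto simp: chain_concat_def eps_chain_def)
  then have "eps_homotopic Y \<delta> (chain_concat \<gamma> [?x, g (f ?x), ?x]) (chain_concat \<gamma> [?x])"
    using eps_chain_mono[OF assms(1)] assms(2) nonneg
    by (intro eps_homotopic_concat eps_homotopic_refl) auto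
  then have "eps_homotopic Y \<delta> \<gamma> ((\<gamma> @ [g (f ?x)]) @ [?x])"
    by (simp add: chain_concat_def eps_homotopic_sym)
  with 1 show ?thesis using eps_homotopic_trans by fastforce
qed

end

text \<open>The bounds on \<sigma> make the refinement scale \<open>\<omega> - \<sigma>\<close>
  positive, let \<open>g\<close> carry \<omega>-homotopies to \<delta>-homotopies and
  \<open>f\<close> carry \<delta>-chains to \<epsilon>-chains, and leave room to lift chains with
  edges below \<open>7 * \<epsilon> / 8\<close>. The last assumption is injectivity of \<phi> in
  terms of chains.\<close>

locale approximate_covering = coarse_inverse Y X f g \<sigma>
  for Y :: "'b metric" and X :: "'a metric" and f :: "'b \<Rightarrow> 'a" and g :: "'a \<Rightarrow> 'b" and \<sigma> :: real +
  fixes q :: 'b and \<epsilon> \<delta> \<omega> :: real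
  assumes geodesic: "geodesic_space Y" "geodesic_space X"
    and base: "q \<in> mspace Y"
    and pos: "0 < \<epsilon>" "0 < \<omega>" "\<epsilon> / 2 < \<delta>"
    and small: "\<sigma> < \<omega>" "\<omega> + 3 * \<sigma> \<le> \<delta>" "\<delta> + \<sigma> \<le> \<epsilon>" "32 * \<sigma> \<le> \<epsilon>"
    and phi_inj: "\<And>\<alpha> \<beta>. eps_chain X \<omega> \<alpha> \<Longrightarrow> hd \<alpha> = f q \<Longrightarrow> eps_chain X \<omega> \<beta> \<Longrightarrow> hd \<beta> = f q \<Longrightarrow>
      eps_homotopic X \<epsilon> \<alpha> \<beta> \<Longrightarrow> eps_homotopic X \<omega> \<alpha> \<beta>"
begin

section \<open>Injectivity on homotopy classes and existence of lifts\<close>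

lemma \<delta>_pos: "0 < \<delta>" using pos by simp

lemma \<omega>_le: "\<omega> \<le> \<epsilon>" using small nonneg by simp

text \<open>Chains in \<open>Y\<close> are refined until their images are \<open>\<omega>\<close>-chains. These are then
  \<open>\<omega>\<close>-homotopic, and \<open>g\<close> carries the homotopy back to \<open>Y\<close>.\<close>

lemma homotopic_if_image_homotopic:
  assumes "eps_chain Y \<delta> \<gamma>" "hd \<gamma> = q" "eps_chain Y \<delta> \<gamma>'" "hd \<gamma>' = q" "last \<gamma> = last \<gamma>'"
    and "eps_homotopic X \<epsilon> (map f \<gamma>) (map f \<gamma>')"
  shows "eps_homotopic Y \<delta> \<gamma> \<gamma>'"
proof -
  obtain \<xi> where \<xi>: "eps_chain Y (\<omega> - \<sigma>) \<xi>" "eps_homotopic Y \<delta> \<gamma> \<xi>"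
    using geodesic_space_refine[OF geodesic(1) assms(1), of "\<omega> - \<sigma>"] small nonneg by auto
  obtain \<xi>' where \<xi>': "eps_chain Y (\<omega> - \<sigma>) \<xi>'" "eps_homotopic Y \<delta> \<gamma>' \<xi>'"
    using geodesic_space_refine[OF geodesic(1) assms(3), of "\<omega> - \<sigma>"] small nonneg by auto
  have ne: "\<xi> \<noteq> []" "\<xi>' \<noteq> []" using \<xi> \<xi>' by (auto simp: eps_chain_def)
  have ends: "hd \<xi> = q" "last \<xi> = last \<gamma>" "hd \<xi>' = q" "last \<xi>' = last \<gamma>"
    using eps_homotopicD[OF \<xi>(2)] eps_homotopicD[OF \<xi>'(2)] assms by auto
  have "eps_homotopic X \<epsilon> (map f \<xi>) (map f \<xi>')"
    using f_homotopic[OF \<xi>(2) small(3)] f_homotopic[OF \<xi>'(2) small(3)] assms(6)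
      eps_homotopic_sym eps_homotopic_trans by blast
  then have "eps_homotopic X \<omega> (map f \<xi>) (map f \<xi>')"
    using f_chain[OF \<xi>(1), of \<omega>] f_chain[OF \<xi>'(1), of \<omega>] ends ne
    by (intro phi_inj) (auto simp: hd_map)
  then have gg: "eps_homotopic Y \<delta> (map g (map f \<xi>)) (map g (map f \<xi>'))"
    using g_homotopic small(2) by blast
  \<comment> \<open>At scale \<open>\<omega> - \<sigma>\<close> the condition of
    \<open>homotopic_g_f\<close> becomes
    \<open>\<omega> + 3 * \<sigma> \<le> \<delta>\<close>.\<close>
  have h: "eps_homotopic Y \<delta> \<xi> (q # map g (map f \<xi>) @ [last \<gamma>])"
    "eps_homotopic Y \<delta> \<xi>' (q # map g (map f \<xi>') @ [last \<gamma>])"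
    using homotopic_g_f[OF \<xi>(1), of \<delta>] homotopic_g_f[OF \<xi>'(1), of \<delta>] small ends by auto
  have "eps_homotopic Y \<delta> (q # map g (map f \<xi>) @ [last \<gamma>]) (q # map g (map f \<xi>') @ [last \<gamma>])"
    using gg eps_homotopicD(2)[OF h(1)] by (rule eps_homotopic_frame)
  then have "eps_homotopic Y \<delta> \<xi> \<xi>'"
    using h eps_homotopic_sym eps_homotopic_trans by blast
  then show ?thesis
    using \<xi>(2) \<xi>'(2) eps_homotopic_sym eps_homotopic_trans by blast
qed

text \<open>The interior points of an \<omega>-chain homotopic to \<zeta> are lifted by
  \<open>g\<close>, the ends by \<open>q\<close> and \<open>v\<close>. Taking \<open>v = q\<close>
  lifts loops to loops; taking \<open>v = g (last \<zeta>)\<close> shows that the image is coarsely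
  dense.\<close>

lemma lift_exists:
  assumes "eps_chain X \<epsilon> \<zeta>" "hd \<zeta> = f q" "v \<in> mspace Y" "mdist X (last \<zeta>) (f v) \<le> \<sigma>"
  obtains W where "eps_chain Y \<delta> W" "hd W = q" "last W = v" "eps_homotopic X \<epsilon> (\<zeta> @ [f v]) (map f W)"
proof -
  \<comment> \<open>With equal scales the bound on the number of points is void; only an
    \<omega>-chain with separate first and last entries is wanted.\<close>
  obtain x zs y where \<eta>: "eps_chain X \<omega> (x # zs @ [y])" "eps_homotopic X \<epsilon> \<zeta> (x # zs @ [y])"
    using geodesic_space_coarsen[OF geodesic(2) assms(1) pos(2) order_refl] \<omega>_le by metis
  have xy: "x = f q" "y = last \<zeta>" using eps_homotopicD[OF \<eta>(2)] assms(2) by auto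
  define W where "W = q # map g zs @ [v]"
  have "set zs \<subseteq> mspace X" "f q \<in> mspace X" using \<eta>(1) f base by (auto simp: eps_chain_def)
  then have W: "lifts (x # zs @ [y]) W"
    using lifts_map[of zs] base assms(3,4) xy nonneg
    by (auto simp: lifts_def W_def intro!: list_all2_appendI)
  have "eps_homotopic X \<epsilon> ((x # zs @ [y]) @ [f (last W)]) (map f W)"
    using small nonneg pos xy by (intro lifts_homotopic[OF \<eta>(1) W]) (auto simp: W_def)
  moreover have "eps_homotopic X \<epsilon> (\<zeta> @ [f v]) ((x # zs @ [y]) @ [f v])"
    using assms f pos small \<delta>_pos by (intro eps_homotopic_snoc \<eta>) auto
  ultimately have "eps_homotopic X \<epsilon> (\<zeta> @ [f v]) (map f W)"
    using eps_homotopic_trans by (auto simp: W_def)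
  moreover have "eps_chain Y \<delta> W"
    using lifts_chain(1)[OF \<eta>(1) W] small(2) eps_chain_mono by blast
  ultimately show ?thesis using that by (simp add: W_def)
qed

section \<open>Comparison of distances between classes and between their images\<close>

context
  fixes \<alpha> \<beta> :: "'b list"
  assumes \<alpha>: "eps_chain Y \<delta> \<alpha>" "hd \<alpha> = q" and \<beta>: "eps_chain Y \<delta> \<beta>" "hd \<beta> = q"
begin

lemma image_chains: 
  "eps_chain X \<epsilon> (map f \<alpha>)" "hd (map f \<alpha>) = f q" "eps_chain X \<epsilon> (map f \<beta>)" "hd (map f \<beta>) = f q"
  using \<alpha> \<beta> f_chain[OF _ small(3)] by (auto simp: eps_chain_def hd_map)

lemma map_chain_between:
  "map f (chain_concat (rev \<alpha>) \<beta>) = chain_concat (rev (map f \<alpha>)) (map f \<beta>)"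
  by (simp add: map_chain_concat rev_map)

text \<open>Coarsening with \<open>s = \<delta>\<close> and \<open>\<mu> = \<epsilon> / 4\<close>
  charges more than \<open>\<epsilon> / 4\<close> per interior point, as
  \<open>\<epsilon> / 2 < \<delta>\<close>. So a chain of length \<open>L\<close> has at most
  \<open>4 * L / \<epsilon>\<close> of them, and \<open>f\<close> adds at most \<sigma> per edge.
  The bound is solved for \<open>L\<close> in order to pass to the infimum.\<close>

lemma dist_image_le:
  "eps_dist X (f q) \<epsilon> (eps_class X \<epsilon> (map f \<alpha>)) (eps_class X \<epsilon> (map f \<beta>))
    \<le> (1 + 4 * \<sigma> / \<epsilon>) * eps_dist Y q \<delta> (eps_class Y \<delta> \<alpha>) (eps_class Y \<delta> \<beta>) + \<sigma>" (is "?D' \<le> ?k * ?D + \<sigma>")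
proof -
  have k: "0 < ?k" using pos nonneg by (simp add: add_pos_nonneg)
  have "(?D' - \<sigma>) / ?k \<le> ?D"
  proof (rule eps_dist_ge[OF \<alpha> \<beta>])
    fix \<gamma> assume \<gamma>: "eps_homotopic Y \<delta> (chain_concat (rev \<alpha>) \<beta>) \<gamma>"
    obtain x zs y where \<eta>: "eps_chain Y \<delta> (x # zs @ [y])" "eps_homotopic Y \<delta> \<gamma> (x # zs @ [y])"
      "chain_length Y (x # zs @ [y]) \<le> chain_length Y \<gamma>"
      "real (length zs) * (\<delta> - \<epsilon> / 4) \<le> chain_length Y \<gamma>"
      using geodesic_space_coarsen[OF geodesic(1) eps_homotopicD(2)[OF \<gamma>], of "\<epsilon> / 4" \<delta>] pos by auto
    have "real (length zs) * (\<epsilon> / 4) \<le> real (length zs) * (\<delta> - \<epsilon> / 4)"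
      using pos by (intro mult_left_mono) auto
    then have n: "real (length zs) \<le> 4 * chain_length Y \<gamma> / \<epsilon>"
      using \<eta>(4) pos by (simp add: field_simps)
    have "eps_homotopic Y \<delta> (chain_concat (rev \<alpha>) \<beta>) (x # zs @ [y])"
      using \<gamma> \<eta>(2) eps_homotopic_trans by blast
    then have "eps_homotopic X \<epsilon> (map f (x # zs @ [y])) (chain_concat (rev (map f \<alpha>)) (map f \<beta>))"
      using f_homotopic[OF _ small(3)] eps_homotopic_sym unfolding map_chain_between[symmetric] by blast
    then have "?D' \<le> chain_length X (map f (x # zs @ [y]))"
      by (intro eps_dist_le image_chains)
    also have "\<dots> \<le> chain_length Y (x # zs @ [y]) + \<sigma> * (real (length (x # zs @ [y])) - 1)"
      using \<eta>(1) by (intro image_length) (auto simp: eps_chain_def)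
    also have "\<dots> = chain_length Y (x # zs @ [y]) + \<sigma> * (real (length zs) + 1)" by simp
    also have "\<dots> \<le> chain_length Y \<gamma> + \<sigma> * (4 * chain_length Y \<gamma> / \<epsilon> + 1)"
      using \<eta>(3) n nonneg by (intro add_mono mult_left_mono) auto
    also have "\<dots> = ?k * chain_length Y \<gamma> + \<sigma>" by (simp add: algebra_simps)
    finally show "(?D' - \<sigma>) / ?k \<le> chain_length Y \<gamma>"
      using k by (simp add: pos_divide_le_eq mult.commute)
  qed
  then show ?thesis using k by (simp add: pos_divide_le_eq mult.commute)
qed

text \<open>Interior points of a lifted chain contribute an error of \<open>3\<sigma>\<close> each, and the two ends together
  only \<open>\<sigma>\<close>. Edges of length at least \<open>3\<epsilon>/4\<close> therefore give the factor \<open>4/\<epsilon>\<close>.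
  The lift need not be a \<open>\<delta>\<close>-chain, so it has to be refined again.\<close>

lemma dist_le_image:
  "eps_dist Y q \<delta> (eps_class Y \<delta> \<alpha>) (eps_class Y \<delta> \<beta>)
    \<le> (1 + 4 * \<sigma> / \<epsilon>) * eps_dist X (f q) \<epsilon> (eps_class X \<epsilon> (map f \<alpha>)) (eps_class X \<epsilon> (map f \<beta>)) + \<sigma>"
    (is "?D \<le> ?k * ?D' + \<sigma>")
proof -
  have k: "0 < ?k" using pos nonneg by (simp add: add_pos_nonneg)
  have ne: "\<alpha> \<noteq> []" "\<beta> \<noteq> []" using \<alpha> \<beta> by (auto simp: eps_chain_def)
  define u v where "u = last \<alpha>" and "v = last \<beta>"
  have uv: "u \<in> mspace Y" "v \<in> mspace Y"
    using ne \<alpha>(1) \<beta>(1) last_in_set unfolding u_def v_def eps_chain_def by blast+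
  have "(?D - \<sigma>) / ?k \<le> ?D'"
  proof (rule eps_dist_ge[OF image_chains])
    fix \<gamma> assume \<gamma>: "eps_homotopic X \<epsilon> (chain_concat (rev (map f \<alpha>)) (map f \<beta>)) \<gamma>"
    obtain x zs y where \<eta>: "eps_chain X (7 * \<epsilon> / 8) (x # zs @ [y])" "eps_homotopic X \<epsilon> \<gamma> (x # zs @ [y])"
      "chain_length X (x # zs @ [y]) \<le> chain_length X \<gamma>"
      "real (length zs) * (7 * \<epsilon> / 8 - \<epsilon> / 8) \<le> chain_length X \<gamma>"
      using geodesic_space_coarsen[OF geodesic(2) eps_homotopicD(2)[OF \<gamma>], of "\<epsilon> / 8" "7 * \<epsilon> / 8"] pos
      by auto
    have \<eta>': "eps_homotopic X \<epsilon> (chain_concat (rev (map f \<alpha>)) (map f \<beta>)) (x # zs @ [y])"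
      using \<gamma> \<eta>(2) eps_homotopic_trans by blast
    have xy: "x = f u" "y = f v"
      using eps_homotopicD(3,4)[OF \<eta>'] ne \<alpha>(2) \<beta>(2)
      by (auto simp: u_def v_def chain_concat_simps(1,2) hd_rev last_rev last_map hd_map)
    define W where "W = u # map g zs @ [v]"
    have sub: "set (x # zs @ [y]) \<subseteq> mspace X" using \<eta>(1) by (simp add: eps_chain_def)
    then have W: "lifts (x # zs @ [y]) W"
      using lifts_map[of zs] uv xy nonneg
      by (auto simp: lifts_def W_def intro!: list_all2_appendI)
    have "eps_homotopic X \<epsilon> ((x # zs @ [y]) @ [f (last W)]) (map f W)"
      using small pos nonneg xy by (intro lifts_homotopic[OF \<eta>(1) W]) (auto simp: W_def)
    moreover have "eps_homotopic X \<epsilon> ((x # zs @ [y]) @ [last (x # zs @ [y])]) (x # zs @ [y])"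
      using eps_homotopicD(2)[OF \<eta>'] pos(1) by (rule eps_homotopic_double_last)
    moreover have "f (last W) = last (x # zs @ [y])" using xy by (simp add: W_def)
    ultimately have fW: "eps_homotopic X \<epsilon> (x # zs @ [y]) (map f W)"
      using eps_homotopic_sym eps_homotopic_trans by metis
    \<comment> \<open>Lifting enlarges \<open>7 * \<epsilon> / 8\<close> by
      \<open>3 * \<sigma>\<close>, and \<open>32 * \<sigma> \<le> \<epsilon>\<close> keeps this
      within \<open>\<epsilon> - \<sigma>\<close>. At that scale \<open>f\<close> still carries the
      refinement of \<open>W\<close> to an \<epsilon>-homotopy.\<close>
    have "eps_chain Y (\<epsilon> - \<sigma>) W"
      using lifts_chain(1)[OF \<eta>(1) W] small(4) by (auto intro: eps_chain_mono)
    then obtain \<xi> where \<xi>: "eps_chain Y \<delta> \<xi>" "eps_homotopic Y (\<epsilon> - \<sigma>) W \<xi>"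
      "chain_length Y \<xi> = chain_length Y W"
      using geodesic_space_refine[OF geodesic(1) _ \<delta>_pos, of "\<epsilon> - \<sigma>"] small(3) by auto
    have ends: "hd \<xi> = u" "last \<xi> = v" "\<xi> \<noteq> []"
      using eps_homotopicD[OF \<xi>(2)] by (auto simp: W_def eps_chain_def)
    have "eps_homotopic X \<epsilon> (chain_concat (rev (map f \<alpha>)) (map f \<beta>)) (map f \<xi>)"
      using \<eta>' fW f_homotopic[OF \<xi>(2)] eps_homotopic_trans by (metis diff_add_cancel order_refl)
    \<comment> \<open>Injectivity is available only for chains that start at the base point, so
      \<alpha> is prepended here and cancelled again afterwards.\<close>
    then have "eps_homotopic X \<epsilon> (map f (chain_concat \<alpha> \<xi>)) (map f \<beta>)"
      using eps_homotopic_cancel'[OF image_chains(1) pos(1) image_chains(3)] image_chains(2,4)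
      by (simp add: map_chain_concat)
    then have "eps_homotopic Y \<delta> (chain_concat \<alpha> \<xi>) \<beta>"
      using \<alpha> \<beta> \<xi>(1) ends ne
      by (intro homotopic_if_image_homotopic eps_chain_concat)
        (auto simp: chain_concat_simps(1,2) u_def v_def)
    then have "eps_homotopic Y \<delta> \<xi> (chain_concat (rev \<alpha>) \<beta>)"
      using \<alpha>(1) \<xi>(1) ends \<delta>_pos by (intro eps_homotopic_cancel) (auto simp: u_def)
    then have "?D \<le> chain_length Y W"
      unfolding \<xi>(3)[symmetric] by (intro eps_dist_le \<alpha> \<beta>)
    also have "\<dots> \<le> chain_length X (x # zs @ [y]) + 3 * \<sigma> * real (length zs) + \<sigma> + mdist X x (f u)"
      using W sub xy unfolding W_def by (intro lifts_length) auto
    also have "\<dots> = chain_length X (x # zs @ [y]) + \<sigma> * (3 * real (length zs)) + \<sigma>"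
      using xy sub by simp
    also have "\<dots> \<le> chain_length X \<gamma> + \<sigma> * (4 * chain_length X \<gamma> / \<epsilon>) + \<sigma>"
      using \<eta>(3,4) pos nonneg by (intro add_mono mult_left_mono order_refl) (auto simp: field_simps)
    also have "\<dots> = ?k * chain_length X \<gamma> + \<sigma>" by (simp add: algebra_simps)
    finally show "(?D - \<sigma>) / ?k \<le> chain_length X \<gamma>"
      using k by (simp add: pos_divide_le_eq mult.commute)
  qed
  then show ?thesis using k by (simp add: pos_divide_le_eq mult.commute)
qed

end


section \<open>The induced map on classes, on the group and on the action\<close>

lemma induces_f: "induces f Y q \<delta> X (f q) \<epsilon>"
  unfolding induces_def
proof (intro conjI ballI impI)
  fix x y assume "x \<in> mspace Y" "y \<in> mspace Y" "mdist Y x y < \<delta>"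
  then show "mdist X (f x) (f y) < \<epsilon>" using f_le[of x y] small(3) by simp
qed (use f in auto)

lemmas induced_map_eps_class = induced_map_class[OF induces_f]

lemma hd_map_f: "eps_chain Y \<delta> \<alpha> \<Longrightarrow> hd \<alpha> = q \<Longrightarrow> hd (map f \<alpha>) = f q"
  by (auto simp: eps_chain_def hd_map)

lemma last_map_f: "eps_chain Y \<delta> \<alpha> \<Longrightarrow> last (map f \<alpha>) = f (last \<alpha>)"
  by (auto simp: eps_chain_def last_map)

text \<open>Group product and action are both concatenation of classes, so this gives the
  homomorphism property and equivariance at once.\<close>

lemma induced_map_concat:
  assumes "eps_chain Y \<delta> \<alpha>" "eps_chain Y \<delta> \<beta>" "last \<alpha> = hd \<beta>"
  shows "induced_map f X \<epsilon> (class_concat Y \<delta> (eps_class Y \<delta> \<alpha>) (eps_class Y \<delta> \<beta>)) =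
    class_concat X \<epsilon> (induced_map f X \<epsilon> (eps_class Y \<delta> \<alpha>)) (induced_map f X \<epsilon> (eps_class Y \<delta> \<beta>))"
proof -
  have "last (map f \<alpha>) = hd (map f \<beta>)"
    using assms by (auto simp: eps_chain_def last_map hd_map)
  then show ?thesis
    using assms f_chain[OF _ small(3)]
    by (simp add: class_concat_class induced_map_eps_class eps_chain_concat map_chain_concat)
qed

lemma sigma_isometry_induced_map:
  "sigma_isometry (p_poly \<sigma> \<epsilon>) (eps_space Y q \<delta>) (eps_space X (f q) \<epsilon>) (induced_map f X \<epsilon>)"
  unfolding sigma_isometry_def mspace_eps_space[OF \<delta>_pos] mspace_eps_space[OF pos(1)]
    mdist_eps_space[OF \<delta>_pos] mdist_eps_space[OF pos(1)]
proof (intro conjI ballI allI)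
  let ?p = "p_poly \<sigma> \<epsilon>"
  show "degree ?p \<le> 1" by (simp add: p_poly_def)
  show "0 \<le> coeff ?p n" for n
    using pos nonneg by (auto simp: p_poly_def coeff_pCons split: nat.split)
  show "induced_map f X \<epsilon> \<in> eps_carrier Y q \<delta> \<rightarrow> eps_carrier X (f q) \<epsilon>"
  proof
    fix a assume "a \<in> eps_carrier Y q \<delta>"
    then obtain \<alpha> where \<alpha>: "a = eps_class Y \<delta> \<alpha>" "eps_chain Y \<delta> \<alpha>" "hd \<alpha> = q"
      by (rule eps_carrier_cases)
    then show "induced_map f X \<epsilon> a \<in> eps_carrier X (f q) \<epsilon>"
      using f_chain[OF \<alpha>(2) small(3)] hd_map_f by (auto simp: eps_carrier_def induced_map_eps_class)
  qed
next
  fix a b assume "a \<in> eps_carrier Y q \<delta>" "b \<in> eps_carrier Y q \<delta>"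
  then obtain \<alpha> \<beta> where \<alpha>: "a = eps_class Y \<delta> \<alpha>" "eps_chain Y \<delta> \<alpha>" "hd \<alpha> = q"
    and \<beta>: "b = eps_class Y \<delta> \<beta>" "eps_chain Y \<delta> \<beta>" "hd \<beta> = q"
    by (metis eps_carrier_cases)
  define D where "D = eps_dist Y q \<delta> a b"
  define D' where "D' = eps_dist X (f q) \<epsilon> (induced_map f X \<epsilon> a) (induced_map f X \<epsilon> b)"
  \<comment> \<open>With this \<open>r\<close> the polynomial is
    \<open>r * ((1 + r) * t + \<sigma>) + \<sigma>\<close>: the lower estimate has error
    \<open>r * D' + \<sigma>\<close>, and the upper one is substituted for
    \<open>D'\<close>.\<close>
  define r where "r = 4 * \<sigma> / \<epsilon>"
  have r: "0 \<le> r" using pos nonneg by (simp add: r_def)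
  have D: "0 \<le> D" unfolding D_def mdist_eps_space[OF \<delta>_pos, symmetric] by simp
  have up: "D' \<le> (1 + r) * D + \<sigma>" and low: "D \<le> (1 + r) * D' + \<sigma>"
    using dist_image_le[OF \<alpha>(2,3) \<beta>(2,3)] dist_le_image[OF \<alpha>(2,3) \<beta>(2,3)] \<alpha> \<beta>
    by (simp_all add: D_def D'_def r_def induced_map_eps_class)
  have "r * D' \<le> r * ((1 + r) * D + \<sigma>)" using up r by (rule mult_left_mono)
  then have "D - D' \<le> r * ((1 + r) * D + \<sigma>) + \<sigma>" using low by (simp add: algebra_simps)
  also have "\<dots> = poly (p_poly \<sigma> \<epsilon>) D"
    using pos by (simp add: p_poly_def r_def field_simps power2_eq_square)
  finally have 1: "D - D' \<le> poly (p_poly \<sigma> \<epsilon>) D" .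
  have "D' - D \<le> r * D + \<sigma>" using up by (simp add: algebra_simps)
  also have "\<dots> \<le> r * ((1 + r) * D + \<sigma>) + \<sigma>"
    using r D nonneg by (simp add: algebra_simps)
  also have "\<dots> = poly (p_poly \<sigma> \<epsilon>) D"
    using pos by (simp add: p_poly_def r_def field_simps power2_eq_square)
  finally show "\<bar>D - D'\<bar> \<le> poly (p_poly \<sigma> \<epsilon>) D" using 1 by simp
next
  fix z assume "z \<in> eps_carrier X (f q) \<epsilon>"
  then obtain \<zeta> where \<zeta>: "z = eps_class X \<epsilon> \<zeta>" "eps_chain X \<epsilon> \<zeta>" "hd \<zeta> = f q"
    by (rule eps_carrier_cases)
  let ?x = "last \<zeta>"
  have x: "?x \<in> mspace X" using \<zeta>(2) last_in_set by (auto simp: eps_chain_def)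
  then have v: "g ?x \<in> mspace Y" "mdist X ?x (f (g ?x)) \<le> \<sigma>" using g close by auto
  obtain W where W: "eps_chain Y \<delta> W" "hd W = q" "eps_homotopic X \<epsilon> (\<zeta> @ [f (g ?x)]) (map f W)"
    using lift_exists[OF \<zeta>(2,3) v] by blast
  have c: "eps_chain X \<epsilon> [?x, f (g ?x)]"
    using x v f pos small nonneg \<omega>_le by (auto simp: eps_chain_def)
  \<comment> \<open>Cancelling \<zeta> leaves a single edge of length at most \<sigma>, which
    represents the class measured by the distance.\<close>
  have "eps_homotopic X \<epsilon> [?x, f (g ?x)] (chain_concat (rev \<zeta>) (map f W))"
    using W(3) \<zeta>(2) pos(1) c by (intro eps_homotopic_cancel) (auto simp: chain_concat_def)
  then have "eps_dist X (f q) \<epsilon> z (eps_class X \<epsilon> (map f W)) \<le> chain_length X [?x, f (g ?x)]"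
    unfolding \<zeta>(1) using hd_map_f[OF W(1,2)] f_chain[OF W(1) small(3)] by (intro eps_dist_le \<zeta>)
  also have "\<dots> \<le> \<sigma> * 1" using v by simp
  also have "\<dots> \<le> \<sigma> * (4 * \<sigma> / \<epsilon> + 1)"
    using nonneg pos by (intro mult_left_mono) auto
  also have "\<dots> = poly (p_poly \<sigma> \<epsilon>) 0" by (simp add: p_poly_def)
  finally show "\<exists>w\<in>eps_carrier Y q \<delta>. eps_dist X (f q) \<epsilon> z (induced_map f X \<epsilon> w) \<le> poly (p_poly \<sigma> \<epsilon>) 0"
    using W by (intro bexI[of _ "eps_class Y \<delta> W"]) (auto simp: induced_map_eps_class eps_carrier_def)
qed

lemma induced_hom_iso:
  "induced_hom f Y q \<delta> X \<epsilon> \<in> iso (eps_group Y q \<delta>) (eps_group X (f q) \<epsilon>)" (is "?h \<in> iso ?G ?H")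
proof -
  interpret G: group ?G using base \<delta>_pos by (rule group_eps_group)
  have h: "?h (eps_class Y \<delta> \<alpha>) = eps_class X \<epsilon> (map f \<alpha>)"
    if "eps_chain Y \<delta> \<alpha>" "hd \<alpha> = q" "last \<alpha> = q" for \<alpha>
    using that by (simp add: induced_hom_def eps_group_carrierI induced_map_eps_class)
  have "?h \<in> hom ?G ?H"
  proof (rule homI)
    fix a assume a: "a \<in> carrier ?G"
    then obtain \<alpha> where \<alpha>: "a = eps_class Y \<delta> \<alpha>" "eps_chain Y \<delta> \<alpha>" "hd \<alpha> = q" "last \<alpha> = q"
      by (rule eps_group_carrierE)
    then show "?h a \<in> carrier ?H"
      using f_chain[OF \<alpha>(2) small(3)] hd_map_f last_map_f by (auto simp: h intro!: eps_group_carrierI)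
    fix b assume b: "b \<in> carrier ?G"
    then obtain \<beta> where \<beta>: "b = eps_class Y \<delta> \<beta>" "eps_chain Y \<delta> \<beta>" "hd \<beta> = q" "last \<beta> = q"
      by (rule eps_group_carrierE)
    show "?h (a \<otimes>\<^bsub>?G\<^esub> b) = ?h a \<otimes>\<^bsub>?H\<^esub> ?h b"
      using G.m_closed[OF a b] a b \<alpha> \<beta> induced_map_concat[of \<alpha> \<beta>]
      by (simp add: induced_hom_def eps_group_mult)
  qed
  moreover have "inj_on ?h (carrier ?G)"
  proof (rule inj_onI)
    fix a b assume "a \<in> carrier ?G" "b \<in> carrier ?G" and eq: "?h a = ?h b"
    then obtain \<alpha> \<beta> where \<alpha>: "a = eps_class Y \<delta> \<alpha>" "eps_chain Y \<delta> \<alpha>" "hd \<alpha> = q" "last \<alpha> = q"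
      and \<beta>: "b = eps_class Y \<delta> \<beta>" "eps_chain Y \<delta> \<beta>" "hd \<beta> = q" "last \<beta> = q"
      by (metis eps_group_carrierE)
    have "eps_homotopic X \<epsilon> (map f \<alpha>) (map f \<beta>)"
      using eq \<alpha> \<beta> f_chain[OF \<alpha>(2) small(3)] by (simp add: h eps_class_eq_iff)
    then have "eps_homotopic Y \<delta> \<alpha> \<beta>"
      using \<alpha> \<beta> by (intro homotopic_if_image_homotopic) auto
    then show "a = b" using \<alpha> \<beta> by (simp add: eps_class_eq_iff)
  qed
  moreover have "carrier ?H \<subseteq> ?h ` carrier ?G"
  proof
    fix z assume "z \<in> carrier ?H"
    then obtain \<zeta> where \<zeta>: "z = eps_class X \<epsilon> \<zeta>" "eps_chain X \<epsilon> \<zeta>" "hd \<zeta> = f q" "last \<zeta> = f q"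
      by (rule eps_group_carrierE)
    have "f q \<in> mspace X" using f base by auto
    \<comment> \<open>The loop ends exactly at \<open>f q\<close>, so the lift can be made to end at
      \<open>q\<close>; the repeated last point is removed afterwards.\<close>
    then obtain W where W: "eps_chain Y \<delta> W" "hd W = q" "last W = q"
      "eps_homotopic X \<epsilon> (\<zeta> @ [f q]) (map f W)"
      using lift_exists[OF \<zeta>(2,3) base] \<zeta>(4) nonneg by auto
    have "eps_homotopic X \<epsilon> (\<zeta> @ [f q]) \<zeta>"
      using eps_homotopic_double_last[OF \<zeta>(2) pos(1)] \<zeta>(4) by simp
    then have "eps_homotopic X \<epsilon> \<zeta> (map f W)"
      using W(4) eps_homotopic_sym eps_homotopic_trans by blast
    then have "z = ?h (eps_class Y \<delta> W)"
      using W \<zeta> by (simp add: h eps_class_eq_iff)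
    then show "z \<in> ?h ` carrier ?G" using W by (auto intro: eps_group_carrierI)
  qed
  ultimately show ?thesis
    by (auto simp: iso_def bij_betw_def hom_def)
qed

lemma induced_map_equivariant:
  assumes "a \<in> carrier (eps_group Y q \<delta>)" "x \<in> mspace (eps_space Y q \<delta>)"
  shows "induced_map f X \<epsilon> (eps_action Y \<delta> a x) =
    eps_action X \<epsilon> (induced_hom f Y q \<delta> X \<epsilon> a) (induced_map f X \<epsilon> x)"
proof -
  obtain \<alpha> where \<alpha>: "a = eps_class Y \<delta> \<alpha>" "eps_chain Y \<delta> \<alpha>" "last \<alpha> = q"
    using assms(1) by (rule eps_group_carrierE)
  obtain \<beta> where \<beta>: "x = eps_class Y \<delta> \<beta>" "eps_chain Y \<delta> \<beta>" "hd \<beta> = q"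
    using assms(2) unfolding mspace_eps_space[OF \<delta>_pos] by (rule eps_carrier_cases)
  show ?thesis
    using induced_map_concat[of \<alpha> \<beta>] \<alpha> \<beta> assms(1) by (simp add: eps_action_def induced_hom_def)
qed

end

section \<open>Pointed Gromov-Hausdorff convergence\<close>

text \<open>Only balls of a fixed radius matter, and on these an affine error with vanishing
  coefficients is uniformly small, even though it grows with the distance.\<close>

lemma pointed_GH_convergent_if_sigma_isometry:
  fixes P :: "nat \<Rightarrow> real poly"
  assumes iso: "\<forall>\<^sub>F i in sequentially. sigma_isometry (P i) (Xs i) X (F i) \<and> ps i \<in> mspace (Xs i) \<and> F i (ps i) = p"
    and lim: "(\<lambda>i. coeff (P i) 0) \<longlonglongrightarrow> 0" "(\<lambda>i. coeff (P i) 1) \<longlonglongrightarrow> 0"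
  shows "pointed_GH_convergent Xs ps X p"
  unfolding pointed_GH_convergent_def
proof (intro allI impI)
  fix r e :: real assume r: "0 < r" and e: "0 < e"
  \<comment> \<open>For error \<open>b + a * t\<close>, the distortion on the ball requires
    \<open>b + 2 * a * r < e\<close> and the covering of the smaller ball
    \<open>2 * b + a * r < e\<close>; this sum dominates both.\<close>
  have "(\<lambda>i. 2 * coeff (P i) 0 + coeff (P i) 1 * (2 * r)) \<longlonglongrightarrow> 2 * 0 + 0 * (2 * r)"
    by (intro tendsto_intros lim)
  then have "\<forall>\<^sub>F i in sequentially. 2 * coeff (P i) 0 + coeff (P i) 1 * (2 * r) < e"
    using e by (intro order_tendstoD) auto
  moreover have "\<forall>\<^sub>F i in sequentially. coeff (P i) 1 < 1"
    using lim(2) by (intro order_tendstoD) auto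
  ultimately show "\<forall>\<^sub>F i in sequentially. \<exists>f. f \<in> mball_of (Xs i) (ps i) r \<rightarrow> mspace X \<and> f (ps i) = p \<and>
      distortion (Xs i) X (mball_of (Xs i) (ps i) r) f < ennreal e \<and>
      mball_of X p (r - e) \<subseteq> (\<Union>x \<in> mball_of (Xs i) (ps i) r. mball_of X (f x) e)"
    using iso
  proof eventually_elim
    case (elim i)
    define b a where "b = coeff (P i) 0" and "a = coeff (P i) 1"
    let ?B = "mball_of (Xs i) (ps i) r"
    have S: "degree (P i) \<le> 1" "0 \<le> a" "0 \<le> b" "F i \<in> mspace (Xs i) \<rightarrow> mspace X"
      and S1: "\<And>x y. x \<in> mspace (Xs i) \<Longrightarrow> y \<in> mspace (Xs i) \<Longrightarrow>
        \<bar>mdist (Xs i) x y - mdist X (F i x) (F i y)\<bar> \<le> poly (P i) (mdist (Xs i) x y)"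
      and S2: "\<And>z. z \<in> mspace X \<Longrightarrow> \<exists>w\<in>mspace (Xs i). mdist X z (F i w) \<le> poly (P i) 0"
      and base: "ps i \<in> mspace (Xs i)" "F i (ps i) = p"
      using elim by (auto simp: sigma_isometry_def a_def b_def)
    have "P i = [:b, a:]"
      using S(1) by (intro poly_eqI) (auto simp: a_def b_def coeff_pCons coeff_eq_0 split: nat.split)
    then have P: "poly (P i) t = b + a * t" for t by (simp add: mult.commute)
    have ab: "2 * b + a * (2 * r) < e" "a < 1" using elim by (auto simp: a_def b_def)
    have "distortion (Xs i) X ?B (F i) \<le> ennreal (b + a * (2 * r))"
      unfolding distortion_def
    proof (intro SUP_least ennreal_leI)
      fix x y assume xy: "x \<in> ?B" "y \<in> ?B"
      then have "mdist (Xs i) x y \<le> mdist (Xs i) x (ps i) + mdist (Xs i) (ps i) y"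
        by (intro mdist_triangle) auto
      then have "mdist (Xs i) x y \<le> 2 * r" using xy by (simp add: mdist_commute)
      then have "a * mdist (Xs i) x y \<le> a * (2 * r)" using S(2) by (rule mult_left_mono)
      then show "\<bar>mdist X (F i x) (F i y) - mdist (Xs i) x y\<bar> \<le> b + a * (2 * r)"
        using S1[of x y] xy by (simp add: P)
    qed
    also have "\<dots> < ennreal e" using ab S(3) e by (intro ennreal_lessI) auto
    finally have "distortion (Xs i) X ?B (F i) < ennreal e" .
    moreover have "mball_of X p (r - e) \<subseteq> (\<Union>x \<in> ?B. mball_of X (F i x) e)"
    proof
      fix z assume "z \<in> mball_of X p (r - e)"
      then have z: "z \<in> mspace X" "p \<in> mspace X" "mdist X p z < r - e" by auto
      obtain w where w: "w \<in> mspace (Xs i)" "mdist X z (F i w) \<le> b"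
        using S2[OF z(1)] by (auto simp: P)
      define D where "D = mdist (Xs i) (ps i) w"
      have Fw: "F i w \<in> mspace X" using S(4) w by auto
      have "mdist X p (F i w) \<le> mdist X p z + mdist X z (F i w)"
        using z Fw by (intro mdist_triangle)
      moreover have "D - mdist X p (F i w) \<le> b + a * D"
        using S1[OF base(1) w(1)] base(2) by (simp add: P D_def)
      \<comment> \<open>The error depends on \<open>D\<close> itself, so it is moved to the left;
        \<open>a < 1\<close> then allows the comparison with \<open>r\<close>.\<close>
      ultimately have *: "(1 - a) * D < r - e + 2 * b" using z w by (simp add: algebra_simps)
      have ar: "0 \<le> a * r" using S(2) r by simp
      have "D < r"
      proof (rule ccontr)
        assume "\<not> D < r"
        then have "(1 - a) * r \<le> (1 - a) * D" using ab by (intro mult_left_mono) auto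
        then show False using * ab(1) ar by (simp add: algebra_simps)
      qed
      moreover have "b < e" using ab S(3) ar by simp
      ultimately show "z \<in> (\<Union>x \<in> ?B. mball_of X (F i x) e)"
        using w base z Fw by (intro UN_I[of w]) (auto simp: D_def mdist_commute)
    qed
    ultimately show ?case using S(4) base by (intro exI[of _ "F i"]) auto
  qed
qed

section \<open>Choice of large \<open>i\<close> and passage to the limit\<close>

theorem theorem32:
  fixes X :: "'a metric" and p :: 'a
    and Xs :: "nat \<Rightarrow> 'b metric" and ps :: "nat \<Rightarrow> 'b"
    and f :: "nat \<Rightarrow> 'b \<Rightarrow> 'a" and \<sigma> :: "nat \<Rightarrow> real"
    and \<epsilon> \<delta> \<omega>\<^sub>0 :: real
  assumes "compact_geodesic_space X" and "p \<in> mspace X"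
    and "\<And>i. compact_geodesic_space (Xs i)" and "\<And>i. ps i \<in> mspace (Xs i)"
    and "\<And>i. f i (ps i) = p"
    and "\<And>i. sigma_isometry [:\<sigma> i:] (Xs i) X (f i)"
    and "\<sigma> \<longlonglongrightarrow> 0"
    and "\<epsilon> > 0"
    and "inj_on (phi X \<epsilon>) (mspace (eps_space X p \<omega>\<^sub>0))"
    and "\<epsilon> / 2 < \<omega>\<^sub>0" and "\<omega>\<^sub>0 < \<delta>" and "\<delta> < \<epsilon>"
  shows "(\<forall>\<^sub>F i in sequentially.
            induces (f i) (Xs i) (ps i) \<delta> X p \<epsilon> \<and>
            sigma_isometry (p_poly (\<sigma> i) \<epsilon>)
              (eps_space (Xs i) (ps i) \<delta>) (eps_space X p \<epsilon>) (induced_map (f i) X \<epsilon>) \<and>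
            induced_hom (f i) (Xs i) (ps i) \<delta> X \<epsilon>
              \<in> iso (eps_group (Xs i) (ps i) \<delta>) (eps_group X p \<epsilon>) \<and>
            (\<forall>g \<in> carrier (eps_group (Xs i) (ps i) \<delta>).
               \<forall>x \<in> mspace (eps_space (Xs i) (ps i) \<delta>).
                 induced_map (f i) X \<epsilon> (eps_action (Xs i) \<delta> g x) =
                 eps_action X \<epsilon> (induced_hom (f i) (Xs i) (ps i) \<delta> X \<epsilon> g)
                   (induced_map (f i) X \<epsilon> x))) \<and>
         pointed_GH_convergent
           (\<lambda>i. eps_space (Xs i) (ps i) \<delta>) (\<lambda>i. eps_class (Xs i) \<delta> [ps i])
           (eps_space X p \<epsilon>) (eps_class X \<epsilon> [p])"
    (is "(\<forall>\<^sub>F i in sequentially. ?A i) \<and> ?GH")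
proof
  have pos: "0 < \<omega>\<^sub>0" "0 < \<delta>" using assms by auto
  have phi_inj: "eps_homotopic X \<omega>\<^sub>0 \<alpha> \<beta>"
    if "eps_chain X \<omega>\<^sub>0 \<alpha>" "hd \<alpha> = p" "eps_chain X \<omega>\<^sub>0 \<beta>" "hd \<beta> = p" "eps_homotopic X \<epsilon> \<alpha> \<beta>" for \<alpha> \<beta>
  proof -
    have "phi X \<epsilon> (eps_class X \<omega>\<^sub>0 \<alpha>) = phi X \<epsilon> (eps_class X \<omega>\<^sub>0 \<beta>)"
      using that assms by (simp add: phi_class eps_class_eq_iff eps_homotopicD(1))
    then have "eps_class X \<omega>\<^sub>0 \<alpha> = eps_class X \<omega>\<^sub>0 \<beta>"
      using that assms(9) unfolding mspace_eps_space[OF pos(1)]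
      by (elim inj_onD) (auto simp: eps_carrier_def)
    then show ?thesis using that eps_class_eq_iff by blast
  qed
  have small: "\<forall>\<^sub>F i in sequentially. \<sigma> i < c" if "0 < c" for c
    using assms(7) that by (rule order_tendstoD)
  \<comment> \<open>These four bounds are what the smallness conditions of
    \<open>approximate_covering\<close> ask for.\<close>
  have "\<forall>\<^sub>F i in sequentially. \<sigma> i < \<omega>\<^sub>0 \<and> \<sigma> i < (\<delta> - \<omega>\<^sub>0) / 3 \<and> \<sigma> i < \<epsilon> - \<delta> \<and> \<sigma> i < \<epsilon> / 32"
    using assms pos by (intro eventually_conj small) auto
  then show A: "\<forall>\<^sub>F i in sequentially. ?A i"
  proof eventually_elim
    case (elim i)
    \<comment> \<open>Nonnegativity is read off from the coefficient of index 0 of the constant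
      polynomial.\<close>
    have S: "0 \<le> \<sigma> i" "f i \<in> mspace (Xs i) \<rightarrow> mspace X"
      and S1: "\<And>x y. x \<in> mspace (Xs i) \<Longrightarrow> y \<in> mspace (Xs i) \<Longrightarrow>
        \<bar>mdist (Xs i) x y - mdist X (f i x) (f i y)\<bar> \<le> \<sigma> i"
      and S2: "\<forall>z\<in>mspace X. \<exists>w. w \<in> mspace (Xs i) \<and> mdist X z (f i w) \<le> \<sigma> i"
      using assms(6)[of i] by (auto simp: sigma_isometry_def Bex_def dest: spec[of _ 0])
    obtain g where g: "\<forall>z\<in>mspace X. g z \<in> mspace (Xs i) \<and> mdist X z (f i (g z)) \<le> \<sigma> i"
      using bchoice[OF S2] by blast
    interpret approximate_covering "Xs i" X "f i" g "\<sigma> i" "ps i" \<epsilon> \<delta> \<omega>\<^sub>0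
      using S S1 g assms(1,3-5,8,10-12) elim pos phi_inj
      by unfold_locales (auto simp: compact_geodesic_space_def)
    show ?case
      using induces_f sigma_isometry_induced_map induced_hom_iso induced_map_equivariant
      by (simp add: assms(5))
  qed
  show ?GH
  proof (rule pointed_GH_convergent_if_sigma_isometry[where P = "\<lambda>i. p_poly (\<sigma> i) \<epsilon>"
        and F = "\<lambda>i. induced_map (f i) X \<epsilon>"])
    show "\<forall>\<^sub>F i in sequentially.
      sigma_isometry (p_poly (\<sigma> i) \<epsilon>) (eps_space (Xs i) (ps i) \<delta>) (eps_space X p \<epsilon>) (induced_map (f i) X \<epsilon>) \<and>
      eps_class (Xs i) \<delta> [ps i] \<in> mspace (eps_space (Xs i) (ps i) \<delta>) \<and>
      induced_map (f i) X \<epsilon> (eps_class (Xs i) \<delta> [ps i]) = eps_class X \<epsilon> [p]"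
      using A
    proof eventually_elim
      case (elim i)
      have "eps_chain (Xs i) \<delta> [ps i]" using assms(4) by (simp add: eps_chain_def)
      moreover from this have "induced_map (f i) X \<epsilon> (eps_class (Xs i) \<delta> [ps i]) = eps_class X \<epsilon> [p]"
        using induced_map_class[of "f i" "Xs i" "ps i" \<delta> X p \<epsilon> "[ps i]"] elim assms(5) by simp
      ultimately show ?case
        using elim unfolding mspace_eps_space[OF pos(2)] by (auto simp: eps_carrier_def)
    qed
    have "(\<lambda>i. \<sigma> i * (4 * \<sigma> i / \<epsilon> + 1)) \<longlonglongrightarrow> 0 * (4 * 0 / \<epsilon> + 1)"
      "(\<lambda>i. \<sigma> i * (4 / \<epsilon> + 16 * \<sigma> i / \<epsilon>\<^sup>2)) \<longlonglongrightarrow> 0 * (4 / \<epsilon> + 16 * 0 / \<epsilon>\<^sup>2)"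
      using assms(8) by (intro tendsto_intros assms(7); simp)+
    then show "(\<lambda>i. coeff (p_poly (\<sigma> i) \<epsilon>) 0) \<longlonglongrightarrow> 0" "(\<lambda>i. coeff (p_poly (\<sigma> i) \<epsilon>) 1) \<longlonglongrightarrow> 0"
      by (simp_all add: p_poly_def)
  qed
qed

end
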